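(* Let $X$ be a Polish space, $\mu$ a probability measure on $\varGamma_X^\sharp$ with $\mu(\varGamma_X)=1$, and $\{\eta_x\}_{x\in X}$ a family of probability measures on $\mathfrak{X}$ such that $x\mapsto\eta_x(\bar B)$ is measurable for every Borel $\bar B\subset\mathfrak{X}$. Assume that for each $x\in X$ and for $\eta_x$-a.a. $\bar y\in\mathfrak{X}$ the configuration $\mathfrak{p}(\bar y)$ is locally finite and simple. Let $\mu_{\mathrm{cl}}$ be the corresponding cluster measure on $\varGamma_X^\sharp$. (a) If for every compact set $B\subset X$ $$\int_{\varGamma_X}\sum_{x\in\gamma}\eta_x(\mathfrak{X}_B)\,\mu(d\gamma)<\infty,\qquad(\ast)$$ then $\mu_{\mathrm{cl}}$-a.a. configurations $\gamma\in\varGamma_X^\sharp$ are locally finite. (b) If for $\mu$-a.a. $\gamma\in\varGamma_X$ the product measure $\eta^\gamma=\bigotimes_{x\in\gamma}\eta_x$ on $\mathfrak{X}^\gamma$ satisfies $\eta^\gamma(\widetilde{\mathfrak{X}^\gamma})=1$, $(\ast\ast)$, then $\mu_{\mathrm{cl}}$-a.a. configurations $\gamma\in\varGamma_X^\sharp$ are simple. Therefore, if both $(\ast)$ (for all compact $B$) and $(\ast\ast)$ hold, then $\mu_{\mathrm{cl}}$ is concentrated on the proper configuration space $\varGamma_X$.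
   Context: $\varGamma_X^\sharp$ denotes the set of generalised configurations in $X$: measures $\gamma=\sum_i\delta_{x_i}$ for a finite or countably infinite family of points of $X$ (multiple and accumulation points allowed), with the $\sigma$-algebra generated by the sets $\{\gamma(B)=n\}$, $B\in\mathcal{B}(X)$, $n\in\{0,1,2,\dots\}$. A configuration $\gamma$ is locally finite if $\gamma(B)<\infty$ for every compact $B\subset X$, simple if $\gamma(\{x\})\le1$ for all $x\in X$, and proper if it is both; $\varGamma_X$ is the set of proper configurations. $\mathfrak{X}:=\bigsqcup_{n\in\{0,1,\dots\}\cup\{\infty\}}X^n$ (disjoint union topology, $X^0=\{\emptyset\}$). For $\bar y=(y_1,y_2,\dots)\in\mathfrak{X}$ put $\mathfrak{p}(\bar y):=\sum_{y_i\in\bar y}\delta_{y_i}$ (also viewed as the set/multiset of its coordinates). For Borel $B\subset X$, $\mathfrak{X}_B:=\{\bar y\in\mathfrak{X}:\ \text{at least one coordinate of }\bar y\text{ lies in }B\}$. Put $$\tilde{\mathfrak{X}}:=\{\bar y\in\mathfrak{X}: \text{the coordinates of }\bar y\text{ are pairwise distinct}\},$$ $$\widetilde{\mathfrak{X}^\gamma}:=\{\bar y^\gamma=(\bar y_x)_{x\in\gamma}\in(\tilde{\mathfrak{X}})^\gamma:\ \mathfrak{p}(\bar y_{x_1})\cap\mathfrak{p}(\bar y_{x_2})=\emptyset\ \text{ for all }\{x_1,x_2\}\subset\gamma\}.$$ The cluster measure $\mu_{\mathrm{cl}}$ is the distribution on $\varGamma_X^\sharp$ of $\sum_{x\in\gamma_c}\gamma_x'$,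 where $\gamma_c$ has distribution $\mu$ and, given $\gamma_c$, the configurations $\gamma_x'$ ($x\in\gamma_c$) are independent with distributions $\eta_x\circ\mathfrak{p}^{-1}$.
   Formalization: In (b), since the set of simple configurations may be non-measurable, it is shown that the random cluster sum is a.s. simple, that μ_cl-a.a. locally finite configurations are simple, and that μ_cl-a.a. configurations are simple if that set is measurable for the completed μ_cl. *)

theory Defs
  imports "HOL-Probability.Probability"
begin

section \<open>Generalised configurations\<close>

definition superpose :: "'i set \<Rightarrow> ('i \<Rightarrow> 'a::topological_space measure) \<Rightarrow> 'a measure" where
  "superpose I M = measure_of UNIV (sets borel) (\<lambda>A. \<Sum>\<^sub>\<infinity>i\<in>I. emeasure (M i) A)"

text \<open>The index set of the family of points is a finite or infinite set of natural numbers, and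
  \<open>return borel x\<close> is the Dirac measure at \<open>x\<close>.\<close>

definition generalised_configs :: "'a::topological_space measure set" where
  "generalised_configs =
     {\<gamma>. \<exists>(I :: nat set) x. \<gamma> = superpose I (\<lambda>i. return borel (x i))}"

definition config_space :: "'a::topological_space measure measure" where
  "config_space = sigma generalised_configs
     {{\<gamma>\<in>generalised_configs. emeasure \<gamma> B = of_nat n} | B n. B \<in> sets borel}"

definition points :: "'a measure \<Rightarrow> 'a set" where
  "points \<gamma> = {x. emeasure \<gamma> {x} \<noteq> 0}"

definition locally_finite_config :: "'a::topological_space measure \<Rightarrow> bool" where
  "locally_finite_config \<gamma> \<longleftrightarrow> (\<forall>B. compact B \<longrightarrow> emeasure \<gamma> B < \<infinity>)"

definition simple_config :: "'a measure \<Rightarrow> bool" where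
  "simple_config \<gamma> \<longleftrightarrow> (\<forall>x. emeasure \<gamma> {x} \<le> 1)"

definition proper_configs :: "'a::topological_space measure set" where
  "proper_configs =
     {\<gamma>\<in>generalised_configs. locally_finite_config \<gamma> \<and> simple_config \<gamma>}"

section \<open>Finite and infinite sequences of points\<close>

text \<open>An element of the disjoint union of the powers \<open>X\<^sup>n\<close> is a pair \<open>(n, f)\<close>, where \<open>f\<close> is
  extensional on the index set \<open>{i. enat i < n}\<close>; coordinates are numbered from \<open>0\<close>.\<close>

definition seq_topology :: "(enat \<times> (nat \<Rightarrow> 'a::topological_space)) topology" where
  "seq_topology =
     sum_topology (\<lambda>n. product_topology (\<lambda>_. euclidean) {i. enat i < n}) UNIV"

definition seq_space :: "(enat \<times> (nat \<Rightarrow> 'a::topological_space)) measure" where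
  "seq_space = sigma (topspace seq_topology) {U. openin seq_topology U}"

definition indices :: "enat \<times> (nat \<Rightarrow> 'a) \<Rightarrow> nat set" where
  "indices y = {i. enat i < fst y}"

definition coords :: "enat \<times> (nat \<Rightarrow> 'a) \<Rightarrow> 'a set" where
  "coords y = snd y ` indices y"

definition seq_config :: "enat \<times> (nat \<Rightarrow> 'a::topological_space) \<Rightarrow> 'a measure" where
  "seq_config y = superpose (indices y) (\<lambda>i. return borel (snd y i))"

definition hitting :: "'a::topological_space set \<Rightarrow> (enat \<times> (nat \<Rightarrow> 'a)) set" where
  "hitting B = {y\<in>space seq_space. \<exists>i\<in>indices y. snd y i \<in> B}"

definition distinct_seqs :: "(enat \<times> (nat \<Rightarrow> 'a::topological_space)) set" where
  "distinct_seqs = {y\<in>space seq_space. inj_on (snd y) (indices y)}"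

definition disjoint_distinct_families ::
    "'a::topological_space measure \<Rightarrow> ('a \<Rightarrow> enat \<times> (nat \<Rightarrow> 'a)) set" where
  "disjoint_distinct_families \<gamma> =
     {y \<in> points \<gamma> \<rightarrow>\<^sub>E distinct_seqs.
        \<forall>x1\<in>points \<gamma>. \<forall>x2\<in>points \<gamma>. x1 \<noteq> x2 \<longrightarrow> coords (y x1) \<inter> coords (y x2) = {}}"

section \<open>The cluster measure\<close>

text \<open>The joint law of the independent clusters, given the configuration \<open>\<gamma>\<close> of centres.\<close>

definition clusters ::
    "('a::topological_space \<Rightarrow> (enat \<times> (nat \<Rightarrow> 'a)) measure) \<Rightarrow> 'a measure \<Rightarrow>
      ('a \<Rightarrow> 'a measure) measure" where
  "clusters \<eta> \<gamma> = PiM (points \<gamma>) (\<lambda>x. distr (\<eta> x) config_space seq_config)"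

definition cluster_measure ::
    "'a::topological_space measure measure \<Rightarrow>
      ('a \<Rightarrow> (enat \<times> (nat \<Rightarrow> 'a)) measure) \<Rightarrow> 'a measure measure" where
  "cluster_measure \<mu> \<eta> = measure_of generalised_configs (sets config_space)
     (\<lambda>A. \<integral>\<^sup>+\<gamma>. emeasure (distr (clusters \<eta> \<gamma>) config_space (superpose (points \<gamma>))) A \<partial>\<mu>)"

text \<open>The set of simple generalised configurations need not be measurable in \<open>config_space\<close>, not
  even up to null sets of a cluster measure: for a random countable dense set, such as the points
  of an i.i.d. uniform sequence, both this set and its complement have outer measure one.  The
  following predicate expresses that the random configuration whose distribution is the cluster
  measure almost surely has the property \<open>P\<close>, for \<open>P\<close> that need not be measurable.  It follows
  from \<open>AE \<gamma> in cluster_measure \<mu> \<eta>. P \<gamma>\<close>.\<close>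

definition cluster_process_AE ::
    "'a::topological_space measure measure \<Rightarrow>
      ('a \<Rightarrow> (enat \<times> (nat \<Rightarrow> 'a)) measure) \<Rightarrow> ('a measure \<Rightarrow> bool) \<Rightarrow> bool" where
  "cluster_process_AE \<mu> \<eta> P \<longleftrightarrow>
     (AE \<gamma> in \<mu>. AE g in clusters \<eta> \<gamma>. P (superpose (points \<gamma>) g))"

end

theory Submission
  imports Defs
begin

text \<open>Given the centres, the Laplace functional of the cluster process is the exponential of an integral
  with respect to the centre configuration, which makes the law of the process measurable in the
  centres: \<open>cluster_measure \<mu> \<eta>\<close> is a genuine mixture.  For a fixed compact set, \<open>(*)\<close> and the
  Borel--Cantelli lemma leave only finitely many points almost surely.  As a Polish space need not
  have a countable cofinal family of compact sets, passing to all compact sets at once needs a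
  capacity argument: if configurations with an accumulation point had positive outer measure, one
  deterministic compact set would already carry infinitely many points with positive probability.
  Simplicity is measurable only modulo local finiteness; since each single cluster and each sum of
  two clusters is locally finite, it can be tested on pairs of clusters.\<close>

section \<open>Superpositions of point measures\<close>

text \<open>The index set \<open>points \<gamma>\<close> of the product
  \<open>clusters \<eta> \<gamma>\<close> changes with \<gamma>, so these products live on different
  spaces and their dependence on \<gamma> cannot be read off coordinatewise. In the Laplace
  functional the index set survives only as a sum over \<open>points \<gamma>\<close>, which for
  simple \<gamma> is an integral against \<gamma> itself. The mixture has to be secured first, since
  \<open>measure_of\<close> turns a set function that is not countably additive into the zero
  measure. The capacity argument needs a finite measure on the base space whose null sets almost
  surely carry no points. The intensity of the cluster process need not be sigma-finite, so each
  locally finite configuration is replaced by an equivalent measure of mass at most one, chosen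
  measurably, and these are averaged over clusters and centres. Almost sure statements pass to an
  image measure only for measurable events. Other properties are therefore tested through measurable
  ones (counts on one compact set, a measurable hull of the simple configurations) and recovered
  afterwards on the image side.\<close>

lemma infsum_ennreal_count_space:
  fixes f :: "'i \<Rightarrow> ennreal"
  assumes "countable I"
  shows "infsum f I = (\<integral>\<^sup>+i. f i \<partial>count_space I)"
proof (cases "finite I")
  case True
  then show ?thesis by (simp add: nn_integral_count_space_finite)
next
  case False
  let ?b = "from_nat_into I"
  have b: "bij_betw ?b UNIV I" using bij_betw_from_nat_into[OF assms False] .
  have "infsum f I = infsum (\<lambda>n. f (?b n)) UNIV"
    using infsum_reindex_bij_betw[OF b, of f] by simp
  also have "\<dots> = (\<Sum>n. f (?b n))"
  proof -
    have "((\<lambda>n. f (?b n)) has_sum infsum (\<lambda>n. f (?b n)) UNIV) UNIV"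
      by (rule has_sum_infsum, rule nonneg_summable_on_complete) simp
    then show ?thesis by (metis has_sum_imp_sums sums_unique)
  qed
  also have "\<dots> = (\<integral>\<^sup>+n. f (?b n) \<partial>count_space UNIV)" by (simp add: nn_integral_count_space_nat)
  also have "\<dots> = (\<integral>\<^sup>+i. f i \<partial>count_space I)" by (rule nn_integral_bij_count_space[OF b])
  finally show ?thesis .
qed

lemma sets_superpose [simp]: "sets (superpose I M) = sets borel"
  and space_superpose [simp]: "space (superpose I M) = UNIV"
proof -
  show "sets (superpose I M) = sets borel"
    unfolding superpose_def using sets.sigma_sets_eq[of borel] by (subst sets_measure_of) auto
  show "space (superpose I M) = UNIV"
    unfolding superpose_def by (subst space_measure_of) auto
qed

text \<open>Two nonnegative sums commute, which gives countable additivity; without it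
  \<open>measure_of\<close> would return the zero measure.\<close>

lemma emeasure_superpose:
  assumes I: "countable I" and M: "\<And>i. i \<in> I \<Longrightarrow> sets (M i) = sets borel" and A: "A \<in> sets borel"
  shows "emeasure (superpose I M) A = (\<integral>\<^sup>+i. emeasure (M i) A \<partial>count_space I)"
proof -
  have "emeasure (superpose I M) A = (\<Sum>\<^sub>\<infinity>i\<in>I. emeasure (M i) A)"
  proof (rule emeasure_measure_of[OF superpose_def])
    show "countably_additive (sets (superpose I M)) (\<lambda>A. \<Sum>\<^sub>\<infinity>i\<in>I. emeasure (M i) A)"
    proof (rule countably_additiveI)
      fix F :: "nat \<Rightarrow> _"
      assume F: "range F \<subseteq> sets (superpose I M)" "disjoint_family F" "\<Union> (range F) \<in> sets (superpose I M)"
      have "(\<Sum>n. \<Sum>\<^sub>\<infinity>i\<in>I. emeasure (M i) (F n)) = (\<integral>\<^sup>+i. (\<Sum>n. emeasure (M i) (F n)) \<partial>count_space I)"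
        by (simp add: infsum_ennreal_count_space[OF I] nn_integral_suminf)
      also have "\<dots> = (\<integral>\<^sup>+i. emeasure (M i) (\<Union> (range F)) \<partial>count_space I)"
        using F M by (intro nn_integral_cong suminf_emeasure) auto
      finally show "(\<Sum>n. \<Sum>\<^sub>\<infinity>i\<in>I. emeasure (M i) (F n)) = (\<Sum>\<^sub>\<infinity>i\<in>I. emeasure (M i) (\<Union> (range F)))"
        by (simp add: infsum_ennreal_count_space[OF I])
    qed
  qed (use A in \<open>auto simp: positive_def\<close>)
  then show ?thesis by (simp add: infsum_ennreal_count_space[OF I])
qed

lemma nn_integral_superpose:
  assumes I: "countable I" and M: "\<And>i. i \<in> I \<Longrightarrow> sets (M i) = sets borel"
    and f: "f \<in> borel_measurable borel"
  shows "(\<integral>\<^sup>+x. f x \<partial>superpose I M) = (\<integral>\<^sup>+i. (\<integral>\<^sup>+x. f x \<partial>M i) \<partial>count_space I)"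
  using f
proof (induction rule: borel_measurable_induct)
  case (cong f g)
  then have "f = g" by auto
  then show ?case using cong by simp
next
  case (set A)
  then show ?case
    by (simp add: emeasure_superpose[OF I M] M cong: nn_integral_cong_simp)
next
  case (mult u c)
  have "(\<integral>\<^sup>+i. (\<integral>\<^sup>+x. c * u x \<partial>M i) \<partial>count_space I) = (\<integral>\<^sup>+i. c * (\<integral>\<^sup>+x. u x \<partial>M i) \<partial>count_space I)"
    using mult(2) M by (intro nn_integral_cong nn_integral_cmult) (auto simp: measurable_def sets_eq_imp_space_eq[OF M])
  then show ?case using mult by (simp add: nn_integral_cmult measurable_cong_sets[OF sets_superpose refl])
next
  case (add u v)
  have "(\<integral>\<^sup>+i. (\<integral>\<^sup>+x. v x + u x \<partial>M i) \<partial>count_space I)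
      = (\<integral>\<^sup>+i. (\<integral>\<^sup>+x. v x \<partial>M i) + (\<integral>\<^sup>+x. u x \<partial>M i) \<partial>count_space I)"
    using add(1,3) M by (intro nn_integral_cong nn_integral_add) (auto simp: measurable_def sets_eq_imp_space_eq[OF M])
  then show ?case using add by (simp add: nn_integral_add measurable_cong_sets[OF sets_superpose refl])
next
  case (seq U)
  have "(\<integral>\<^sup>+x. (SUP i. U i) x \<partial>superpose I M) = (SUP i. \<integral>\<^sup>+x. U i x \<partial>superpose I M)"
    unfolding SUP_apply using seq(1,3)
    by (intro nn_integral_monotone_convergence_SUP) (auto simp: measurable_cong_sets[OF sets_superpose refl])
  also have "\<dots> = (SUP j. \<integral>\<^sup>+i. \<integral>\<^sup>+x. U j x \<partial>M i \<partial>count_space I)"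
    by (simp add: seq)
  also have "\<dots> = (\<integral>\<^sup>+i. (SUP j. \<integral>\<^sup>+x. U j x \<partial>M i) \<partial>count_space I)"
    using seq(3) by (intro nn_integral_monotone_convergence_SUP[symmetric])
      (auto simp: incseq_def le_fun_def intro!: nn_integral_mono)
  also have "\<dots> = (\<integral>\<^sup>+i. (\<integral>\<^sup>+x. (SUP i. U i) x \<partial>M i) \<partial>count_space I)"
    unfolding SUP_apply using seq(1,3) M
    by (intro nn_integral_cong nn_integral_monotone_convergence_SUP[symmetric])
      (auto simp: measurable_def sets_eq_imp_space_eq[OF M])
  finally show ?case .
qed

lemma superpose_cong: "(\<And>i. i \<in> I \<Longrightarrow> M i = N i) \<Longrightarrow> superpose I M = superpose I N"
  unfolding superpose_def by (simp cong: infsum_cong)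

lemma superpose_reindex:
  assumes "bij_betw f I J"
  shows "superpose I (\<lambda>i. M (f i)) = superpose J M"
  unfolding superpose_def
  using infsum_reindex_bij_betw[OF assms, of "\<lambda>j. emeasure (M j) _"] by simp

lemma superpose_return_generalised:
  assumes "countable I"
  shows "superpose I (\<lambda>i. return borel (x i)) \<in> generalised_configs"
proof -
  let ?y = "\<lambda>n. x (from_nat_into I n)"
  have "superpose I (\<lambda>i. return borel (x i)) = superpose I (\<lambda>i. return borel (?y (to_nat_on I i)))"
    using assms by (intro superpose_cong) simp
  also have "\<dots> = superpose (to_nat_on I ` I) (\<lambda>n. return borel (?y n))"
    using inj_on_to_nat_on[OF assms] by (intro superpose_reindex) (simp add: bij_betw_def)
  finally show ?thesis unfolding generalised_configs_def by (intro CollectI exI)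
qed

lemma generalised_configsE:
  assumes "\<gamma> \<in> generalised_configs"
  obtains I :: "nat set" and x where "\<gamma> = superpose I (\<lambda>i. return borel (x i))"
  using assms unfolding generalised_configs_def by auto

lemma sets_generalised [simp]: "\<gamma> \<in> generalised_configs \<Longrightarrow> sets \<gamma> = sets borel"
  and space_generalised [simp]: "\<gamma> \<in> generalised_configs \<Longrightarrow> space \<gamma> = UNIV"
  by (auto elim: generalised_configsE)

lemma emeasure_superpose_return:
  assumes "countable I" "B \<in> sets borel"
  shows "emeasure (superpose I (\<lambda>i. return borel (x i))) B = emeasure (count_space I) {i\<in>I. x i \<in> B}"
proof -
  have "emeasure (superpose I (\<lambda>i. return borel (x i))) B = (\<integral>\<^sup>+i. emeasure (return borel (x i)) B \<partial>count_space I)"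
    using assms by (intro emeasure_superpose) auto
  also have "\<dots> = (\<integral>\<^sup>+i. indicator {i\<in>I. x i \<in> B} i \<partial>count_space I)"
    using assms by (intro nn_integral_cong) (auto split: split_indicator)
  also have "\<dots> = emeasure (count_space I) {i\<in>I. x i \<in> B}"
    by (intro nn_integral_indicator) auto
  finally show ?thesis .
qed

lemma superpose_superpose:
  fixes J :: "'i \<Rightarrow> 'j set"
  assumes I: "countable I" and J: "\<And>i. i \<in> I \<Longrightarrow> countable (J i)"
  shows "superpose I (\<lambda>i. superpose (J i) (\<lambda>j. return borel (x i j)))
       = superpose (Sigma I J) (\<lambda>(i, j). return borel (x i j))" (is "?l = ?r")
proof (rule measure_eqI)
  fix A assume "A \<in> sets ?l"
  then have A: "A \<in> sets borel" by simp
  \<comment> \<open>The sections \<open>J i\<close> vary with \<open>i\<close>; indicators extend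
    both sums to the full types, where Tonelli for counting measures applies.\<close>
  let ?f = "\<lambda>i j. indicator I i * (indicator (J i) j * indicator A (x i j)) :: ennreal"
  have "emeasure ?l A = (\<integral>\<^sup>+i. (\<integral>\<^sup>+j. indicator A (x i j) \<partial>count_space (J i)) \<partial>count_space I)"
    using A by (simp add: emeasure_superpose I J cong: nn_integral_cong_simp)
  also have "\<dots> = (\<integral>\<^sup>+i. (\<integral>\<^sup>+j. ?f i j \<partial>count_space UNIV) \<partial>count_space UNIV)"
    by (simp add: nn_integral_cmult)
      (simp add: nn_integral_count_space_indicator mult.commute)
  also have "\<dots> = (\<integral>\<^sup>+p. (case p of (i, j) \<Rightarrow> ?f i j) \<partial>count_space UNIV)"
    by (subst nn_integral_fst_count_space[symmetric]) simp
  also have "\<dots> = (\<integral>\<^sup>+p. indicator A (x (fst p) (snd p)) \<partial>count_space (Sigma I J))"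
    by (subst nn_integral_count_space_indicator)
      (auto intro!: nn_integral_cong simp: indicator_def split: if_splits)
  also have "\<dots> = emeasure ?r A"
    using A I J by (subst emeasure_superpose)
      (auto intro!: nn_integral_cong countable_SIGMA simp: case_prod_beta)
  finally show "emeasure ?l A = emeasure ?r A" .
qed simp

lemma superpose_generalised:
  assumes I: "countable I" and g: "\<And>i. i \<in> I \<Longrightarrow> g i \<in> generalised_configs"
  shows "superpose I g \<in> generalised_configs"
proof -
  have "\<forall>i\<in>I. \<exists>J x. g i = superpose (J :: nat set) (\<lambda>j. return borel (x j))"
    using g unfolding generalised_configs_def by auto
  then obtain J x where Jx: "\<And>i. i \<in> I \<Longrightarrow> g i = superpose (J i :: nat set) (\<lambda>j. return borel (x i j))"
    by metis
  have "superpose I g = superpose (Sigma I J) (\<lambda>(i, j). return borel (x i j))"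
    using superpose_superpose[OF I, of J x] superpose_cong[of I g, OF Jx] by simp
  also have "\<dots> \<in> generalised_configs"
    using superpose_return_generalised[of "Sigma I J" "\<lambda>(i, j). x i j"] I
    by (simp add: case_prod_beta' countable_SIGMA)
  finally show ?thesis .
qed

lemma generalised_count:
  assumes "\<gamma> \<in> generalised_configs" "B \<in> sets borel"
  obtains (fin) n where "emeasure \<gamma> B = of_nat n" | (inf) "emeasure \<gamma> B = \<infinity>"
proof -
  from assms(1) obtain I :: "nat set" and x where \<gamma>: "\<gamma> = superpose I (\<lambda>i. return borel (x i))"
    by (rule generalised_configsE)
  show thesis
    using that assms(2) unfolding \<gamma>
    by (cases "finite {i\<in>I. x i \<in> B}") (auto simp: emeasure_superpose_return)
qed

lemma countable_points:
  fixes \<gamma> :: "'a::t1_space measure"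
  assumes "\<gamma> \<in> generalised_configs" shows "countable (points \<gamma>)"
proof -
  from assms obtain I :: "nat set" and x where \<gamma>: "\<gamma> = superpose I (\<lambda>i. return borel (x i))"
    by (rule generalised_configsE)
  have "points \<gamma> \<subseteq> x ` I"
    unfolding points_def \<gamma> by (force simp: emeasure_superpose_return emeasure_count_space_eq_0)
  then show ?thesis by (rule countable_subset) auto
qed

text \<open>A point listed by two indices would have mass at least 2, so the enumeration of a simple
  configuration is a bijection onto its atoms. Sums over \<open>points \<gamma>\<close> thereby
  become integrals against \<gamma>, which depend measurably on \<gamma>.\<close>

lemma simple_eq_superpose_points:
  fixes \<gamma> :: "'a::t1_space measure"
  assumes "\<gamma> \<in> generalised_configs" "simple_config \<gamma>"
  shows "\<gamma> = superpose (points \<gamma>) (return borel)"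
proof -
  from assms obtain I :: "nat set" and x where \<gamma>: "\<gamma> = superpose I (\<lambda>i. return borel (x i))"
    by (elim generalised_configsE)
  have e: "emeasure \<gamma> {p} = emeasure (count_space I) {i\<in>I. x i = p}" for p
    unfolding \<gamma> by (subst emeasure_superpose_return) auto
  have "inj_on x I"
  proof (rule inj_onI, rule ccontr)
    fix i j assume ij: "i \<in> I" "j \<in> I" "x i = x j" "i \<noteq> j"
    have "of_nat 2 = emeasure (count_space I) {i, j}" using ij by (subst emeasure_count_space_finite) auto
    also have "\<dots> \<le> emeasure \<gamma> {x i}" unfolding e using ij by (intro emeasure_mono) auto
    also have "\<dots> \<le> 1" using assms(2) unfolding simple_config_def by auto
    finally show False by simp
  qed
  moreover have "x ` I = points \<gamma>"
    unfolding points_def e by (auto simp: emeasure_count_space_eq_0)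
  ultimately have "bij_betw x I (points \<gamma>)" by (simp add: bij_betw_def)
  from superpose_reindex[OF this, of "return borel"] show ?thesis using \<gamma> by simp
qed

lemma nn_integral_simple:
  fixes \<gamma> :: "'a::t1_space measure"
  assumes "\<gamma> \<in> generalised_configs" "simple_config \<gamma>" "f \<in> borel_measurable borel"
  shows "(\<integral>\<^sup>+x. f x \<partial>\<gamma>) = (\<integral>\<^sup>+x. f x \<partial>count_space (points \<gamma>))"
proof -
  have "(\<integral>\<^sup>+x. f x \<partial>\<gamma>) = (\<integral>\<^sup>+x. f x \<partial>superpose (points \<gamma>) (return borel))"
    using simple_eq_superpose_points[OF assms(1,2)] by simp
  also have "\<dots> = (\<integral>\<^sup>+x. f x \<partial>count_space (points \<gamma>))"
    using assms(3) by (subst nn_integral_superpose)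
      (auto simp: countable_points[OF assms(1)] nn_integral_return intro!: nn_integral_cong)
  finally show ?thesis .
qed

section \<open>Countable sums as limits of finite sums\<close>

lemma finite_to_nat_on_less: "countable I \<Longrightarrow> finite {i \<in> I. to_nat_on I i < n}"
  using inj_on_to_nat_on[of I] finite_imageD[of "to_nat_on I" "{i \<in> I. to_nat_on I i < n}"]
  by (auto intro: finite_subset[of _ "{..<n}"] inj_on_subset)

text \<open>The truncations depend only on the enumeration of \<open>I\<close> and not on
  \<open>f\<close>, so one exhausting sequence serves both sides of the product formula for Laplace
  functionals.\<close>

lemma nn_integral_count_space_countable:
  assumes "countable I"
  shows "(\<lambda>n. \<Sum>i | i \<in> I \<and> to_nat_on I i < n. f i) \<longlonglongrightarrow> (\<integral>\<^sup>+i. f i \<partial>count_space I)"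
proof -
  let ?F = "\<lambda>n. {i\<in>I. to_nat_on I i < n}"
  have fin: "finite (?F n)" for n
    using assms by (rule finite_to_nat_on_less)
  have "(\<lambda>n. \<integral>\<^sup>+i. f i * indicator (?F n) i \<partial>count_space I) \<longlonglongrightarrow> (\<integral>\<^sup>+i. f i * indicator I i \<partial>count_space I)"
  proof (rule nn_integral_LIMSEQ)
    show "incseq (\<lambda>n i. f i * indicator (?F n) i)"
      by (auto simp: incseq_def le_fun_def split: split_indicator)
    show "(\<lambda>n. f i * indicator (?F n) i) \<longlonglongrightarrow> f i * indicator I i" for i
      by (rule tendsto_eventually) (auto simp: eventually_at_top_dense split: split_indicator)
  qed auto
  moreover have "(\<integral>\<^sup>+i. f i * indicator (?F n) i \<partial>count_space I) = (\<Sum>i\<in>?F n. f i)" for n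
  proof -
    have "(\<integral>\<^sup>+i. f i * indicator (?F n) i \<partial>count_space I) = (\<integral>\<^sup>+i. f i \<partial>count_space (?F n))"
      by (subst (1 2) nn_integral_count_space_indicator) (auto intro!: nn_integral_cong split: split_indicator)
    then show ?thesis using fin by (simp add: nn_integral_count_space_finite)
  qed
  moreover have "(\<integral>\<^sup>+i. f i * indicator I i \<partial>count_space I) = (\<integral>\<^sup>+i. f i \<partial>count_space I)"
    by (intro nn_integral_cong) auto
  ultimately show ?thesis by simp
qed

lemma borel_measurable_nn_integral_count_space:
  fixes f :: "'i \<Rightarrow> 'b \<Rightarrow> ennreal"
  assumes "countable I" "\<And>i. i \<in> I \<Longrightarrow> f i \<in> borel_measurable M"
  shows "(\<lambda>\<omega>. \<integral>\<^sup>+i. f i \<omega> \<partial>count_space I) \<in> borel_measurable M"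
proof (cases "finite I")
  case True
  then show ?thesis using assms by (simp add: nn_integral_count_space_finite)
next
  case False
  have "(\<integral>\<^sup>+i. f i \<omega> \<partial>count_space I) = (\<Sum>n. f (from_nat_into I n) \<omega>)" for \<omega>
    by (subst nn_integral_bij_count_space[OF bij_betw_from_nat_into[OF assms(1) False], symmetric])
      (rule nn_integral_count_space_nat)
  then show ?thesis
    using assms(2)[OF from_nat_into[of I]] False by (auto intro!: borel_measurable_suminf_order)
qed

section \<open>Measurability on the configuration space\<close>

lemma space_config_space [simp]: "space config_space = generalised_configs"
  unfolding config_space_def by (rule space_measure_of) auto

lemma sets_config_space: "sets config_space = sigma_sets generalised_configs
     {{\<gamma>\<in>generalised_configs. emeasure \<gamma> B = of_nat n} | B n. B \<in> sets borel}"
  unfolding config_space_def by (rule sets_measure_of) auto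

text \<open>Counts take only the values 0, 1, 2, ... and \<infinity>. The generators fix the finite
  values; the value \<infinity> is the complement of their countable union.\<close>

lemma measurable_config_count [measurable (raw)]:
  assumes "B \<in> sets borel"
  shows "(\<lambda>\<gamma>. emeasure \<gamma> B) \<in> borel_measurable config_space"
proof (rule measurableI)
  fix A :: "ennreal set" assume "A \<in> sets borel"
  let ?E = "\<lambda>n. {\<gamma>\<in>generalised_configs. emeasure \<gamma> B = of_nat n}"
  have E: "?E n \<in> sets config_space" for n
    unfolding sets_config_space using assms by blast
  have "(\<lambda>\<gamma>. emeasure \<gamma> B) -` A \<inter> space config_space
      = (\<Union>n\<in>{n. of_nat n \<in> A}. ?E n) \<union> (if \<infinity> \<in> A then space config_space - (\<Union>n. ?E n) else {})"
  proof (intro set_eqI)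
    fix \<gamma> :: "'a measure"
    show "\<gamma> \<in> (\<lambda>\<gamma>. emeasure \<gamma> B) -` A \<inter> space config_space \<longleftrightarrow>
      \<gamma> \<in> (\<Union>n\<in>{n. of_nat n \<in> A}. ?E n) \<union> (if \<infinity> \<in> A then space config_space - (\<Union>n. ?E n) else {})"
    proof (cases "\<gamma> \<in> generalised_configs")
      case True
      then show ?thesis using assms by (cases rule: generalised_count) auto
    qed auto
  qed
  also have "\<dots> \<in> sets config_space"
    using E by (cases "\<infinity> \<in> A") (auto simp del: space_config_space intro!: sets.Un sets.countable_UN')
  finally show "(\<lambda>\<gamma>. emeasure \<gamma> B) -` A \<inter> space config_space \<in> sets config_space" .
qed auto

lemma measurable_config_sum_list:
  "set bs \<subseteq> sets borel \<Longrightarrow> (\<lambda>\<gamma>. \<Sum>B\<leftarrow>bs. emeasure \<gamma> B) \<in> borel_measurable config_space"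
  by (induction bs) (auto intro!: borel_measurable_add measurable_config_count)

lemma measurable_config_spaceI:
  fixes f :: "'a \<Rightarrow> 'b::topological_space measure"
  assumes "\<And>\<omega>. \<omega> \<in> space M \<Longrightarrow> f \<omega> \<in> generalised_configs"
    and "\<And>B. B \<in> sets borel \<Longrightarrow> (\<lambda>\<omega>. emeasure (f \<omega>) B) \<in> borel_measurable M"
  shows "f \<in> M \<rightarrow>\<^sub>M config_space"
  unfolding config_space_def
proof (rule measurable_measure_of)
  fix A :: "'b measure set"
  assume "A \<in> {{\<gamma>\<in>generalised_configs. emeasure \<gamma> B = of_nat n} | B n. B \<in> sets borel}"
  then obtain B n where A: "A = {\<gamma>\<in>generalised_configs. emeasure \<gamma> B = of_nat n}" and B: "B \<in> sets borel"
    by auto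
  have "f -` A \<inter> space M = {\<omega>\<in>space M. emeasure (f \<omega>) B = of_nat n}"
    using assms(1) unfolding A by auto
  also have "\<dots> \<in> sets M" using assms(2)[OF B] by measurable
  finally show "f -` A \<inter> space M \<in> sets M" .
qed (use assms(1) in auto)

lemma measurable_config_nn_integral [measurable (raw)]:
  assumes "f \<in> borel_measurable borel"
  shows "(\<lambda>\<gamma>. \<integral>\<^sup>+x. f x \<partial>\<gamma>) \<in> borel_measurable config_space"
proof -
  have m: "g \<in> borel_measurable borel \<Longrightarrow> \<gamma> \<in> generalised_configs \<Longrightarrow> g \<in> borel_measurable \<gamma>"
    for g :: "'a \<Rightarrow> ennreal" and \<gamma>
    by (simp add: measurable_cong_sets[OF sets_generalised refl])
  show ?thesis
    using assms
  proof (induction rule: borel_measurable_induct)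
    case (cong f g)
    then have "f = g" by auto
    then show ?case using cong by simp
  next
    case (set A)
    then show ?case
      by (subst measurable_cong[where g="\<lambda>\<gamma>. emeasure \<gamma> A"]) (auto simp: nn_integral_indicator)
  next
    case (mult u c)
    then show ?case
      by (subst measurable_cong[where g="\<lambda>\<gamma>. c * (\<integral>\<^sup>+x. u x \<partial>\<gamma>)"]) (auto simp: nn_integral_cmult m)
  next
    case (add u v)
    have "(\<lambda>\<gamma>. (\<integral>\<^sup>+x. v x \<partial>\<gamma>) + (\<integral>\<^sup>+x. u x \<partial>\<gamma>)) \<in> borel_measurable config_space"
      by (intro borel_measurable_add add.IH)
    moreover have "(\<integral>\<^sup>+x. v x + u x \<partial>\<gamma>) = (\<integral>\<^sup>+x. v x \<partial>\<gamma>) + (\<integral>\<^sup>+x. u x \<partial>\<gamma>)"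
      if "\<gamma> \<in> space config_space" for \<gamma>
      using that by (intro nn_integral_add) (auto intro!: m[OF add.hyps(1)] m[OF add.hyps(3)])
    ultimately show ?case by (subst measurable_cong) assumption+
  next
    case (seq U)
    show ?case unfolding SUP_apply
    proof (subst measurable_cong[where g="\<lambda>\<gamma>. SUP i. \<integral>\<^sup>+x. U i x \<partial>\<gamma>"])
      fix \<gamma> :: "'a measure" assume "\<gamma> \<in> space config_space"
      with seq(1,3) show "(\<integral>\<^sup>+x. (SUP i. U i x) \<partial>\<gamma>) = (SUP i. \<integral>\<^sup>+x. U i x \<partial>\<gamma>)"
        by (intro nn_integral_monotone_convergence_SUP) (auto simp: m)
    qed (use seq in \<open>auto intro!: borel_measurable_SUP\<close>)
  qed
qed

section \<open>Borel structure of the sequence space\<close>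

lemma space_seq_space: "space seq_space = {y. snd y \<in> extensional (indices y)}"
proof -
  have "space seq_space = topspace seq_topology"
    unfolding seq_space_def by (rule space_measure_of) (rule subsetI, simp add: openin_subset)
  also have "\<dots> = Sigma UNIV (\<lambda>n. PiE {i. enat i < n} (\<lambda>_. UNIV))"
    by (simp add: seq_topology_def comp_def)
  also have "\<dots> = {y. snd y \<in> extensional (indices y)}"
    by (rule set_eqI) (auto simp: indices_def PiE_iff extensional_def)
  finally show ?thesis .
qed

lemma sets_seq_space_open: "openin seq_topology U \<Longrightarrow> U \<in> sets seq_space"
  unfolding seq_space_def by (subst sets_measure_of) (rule subsetI, simp_all add: openin_subset)

text \<open>Coordinate \<open>i\<close> exists only on the summands with more than \<open>i\<close>
  coordinates. It is treated as a map on that measurable part; open sets are pulled back summand by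
  summand, with the empty set on the summands that are too short.\<close>

lemma sets_seq_space_coord:
  fixes B :: "'a::topological_space set"
  assumes "B \<in> sets borel"
  shows "{y \<in> space seq_space. i \<in> indices y \<and> snd y i \<in> B} \<in> sets seq_space"
proof -
  let ?D = "{y \<in> space seq_space. i \<in> indices y} :: (enat \<times> (nat \<Rightarrow> 'a)) set"
  have op: "{y \<in> space seq_space. i \<in> indices y \<and> snd y i \<in> U} \<in> sets seq_space" if "open U" for U :: "'a set"
  proof (rule sets_seq_space_open, unfold seq_topology_def openin_sum_topology_alt)
    let ?U = "\<lambda>n. {f \<in> topspace (product_topology (\<lambda>_. euclidean) {i. enat i < n}). enat i < n \<and> f i \<in> U}"
    have "openin (product_topology (\<lambda>_. euclidean) {i. enat i < n}) (?U n)" for n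
    proof (cases "enat i < n")
      case True
      have "openin (product_topology (\<lambda>_. euclidean) {i. enat i < n})
          {f \<in> topspace (product_topology (\<lambda>_. euclidean) {i. enat i < n}). f i \<in> U}"
        using True that
        by (intro openin_continuous_map_preimage[OF continuous_map_product_projection]) auto
      with True show ?thesis by simp
    next
      case False
      then have "?U n = {}" by blast
      then show ?thesis by (simp only: openin_empty)
    qed
    moreover have "{y \<in> space seq_space. i \<in> indices y \<and> snd y i \<in> U} = Sigma UNIV ?U"
      by (auto simp: space_seq_space indices_def PiE_iff)
    ultimately show "\<exists>T. {y \<in> space seq_space. i \<in> indices y \<and> snd y i \<in> U} = Sigma UNIV T \<and>
        (\<forall>n\<in>UNIV. openin (product_topology (\<lambda>_. euclidean) {i. enat i < n}) (T n))"
      by (intro exI[of _ ?U]) simp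
  qed
  have "?D \<in> sets seq_space" using op[of UNIV] by simp
  have "(\<lambda>y. snd y i) \<in> restrict_space seq_space ?D \<rightarrow>\<^sub>M borel"
  proof (rule borel_measurableI)
    fix S :: "'a set" assume "open S"
    have "(\<lambda>y. snd y i) -` S \<inter> space (restrict_space seq_space ?D)
      = ?D \<inter> {y \<in> space seq_space. i \<in> indices y \<and> snd y i \<in> S}"
      by (auto simp: space_restrict_space)
    then show "(\<lambda>y. snd y i) -` S \<inter> space (restrict_space seq_space ?D) \<in> sets (restrict_space seq_space ?D)"
      using op[OF \<open>open S\<close>] unfolding sets_restrict_space by auto
  qed
  from measurable_sets[OF this assms]
  have "(\<lambda>y. snd y i) -` B \<inter> space (restrict_space seq_space ?D) \<in> sets seq_space"
    using \<open>?D \<in> sets seq_space\<close> by (subst (asm) sets_restrict_space_iff) auto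
  also have "(\<lambda>y. snd y i) -` B \<inter> space (restrict_space seq_space ?D)
    = {y \<in> space seq_space. i \<in> indices y \<and> snd y i \<in> B}"
    by (auto simp: space_restrict_space)
  finally show ?thesis .
qed

lemma emeasure_seq_config:
  assumes "B \<in> sets borel"
  shows "emeasure (seq_config y) B = emeasure (count_space (indices y)) {i \<in> indices y. snd y i \<in> B}"
  unfolding seq_config_def using assms by (rule emeasure_superpose_return[OF countableI_type])

lemma seq_config_generalised [simp]: "seq_config y \<in> generalised_configs"
  unfolding seq_config_def by (rule superpose_return_generalised) auto

lemma measurable_seq_config [measurable]: "seq_config \<in> seq_space \<rightarrow>\<^sub>M config_space"
proof (rule measurable_config_spaceI)
  fix B :: "'a set" assume B: "B \<in> sets borel"
  let ?A = "\<lambda>i. {y \<in> space seq_space. i \<in> indices y \<and> snd y i \<in> B}"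
  have "(\<lambda>y. \<Sum>i. indicator (?A i) y :: ennreal) \<in> borel_measurable seq_space"
    using sets_seq_space_coord[OF B] by measurable
  also have "(\<lambda>y. \<Sum>i. indicator (?A i) y :: ennreal) \<in> borel_measurable seq_space \<longleftrightarrow>
     (\<lambda>y. emeasure (seq_config y) B) \<in> borel_measurable seq_space"
  proof (rule measurable_cong)
    fix y :: "enat \<times> (nat \<Rightarrow> 'a)" assume y: "y \<in> space seq_space"
    have "emeasure (seq_config y) B = (\<integral>\<^sup>+i. indicator {i \<in> indices y. snd y i \<in> B} i \<partial>count_space (indices y))"
      unfolding emeasure_seq_config[OF B] by (rule nn_integral_indicator[symmetric]) auto
    also have "\<dots> = (\<integral>\<^sup>+i. indicator (?A i) y \<partial>count_space UNIV)"
      using y by (subst nn_integral_count_space_indicator) (auto intro!: nn_integral_cong split: split_indicator)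
    finally show "(\<Sum>i. indicator (?A i) y) = emeasure (seq_config y) B"
      by (simp add: nn_integral_count_space_nat)
  qed
  finally show "(\<lambda>y. emeasure (seq_config y) B) \<in> borel_measurable seq_space" .
qed simp

text \<open>Letting \<open>I\<close> be smaller than the index set \<open>J\<close> of the product
  covers the superposition of two clusters picked out of the whole family.\<close>

lemma measurable_superpose:
  assumes I: "countable I" "I \<subseteq> J" and M: "\<And>i. i \<in> I \<Longrightarrow> sets (M i) = sets config_space"
  shows "superpose I \<in> PiM J M \<rightarrow>\<^sub>M config_space"
proof (rule measurable_config_spaceI)
  have sp: "g i \<in> generalised_configs" if "g \<in> space (PiM J M)" "i \<in> I" for g i
    using that I sets_eq_imp_space_eq[OF M[OF that(2)]] by (auto simp: space_PiM)
  then show "superpose I g \<in> generalised_configs" if "g \<in> space (PiM J M)" for g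
    using that by (intro superpose_generalised[OF I(1)])
  fix B :: "'b set" assume B: "B \<in> sets borel"
  have "(\<lambda>g. \<integral>\<^sup>+i. emeasure (g i) B \<partial>count_space I) \<in> borel_measurable (PiM J M)"
  proof (rule borel_measurable_nn_integral_count_space[OF I(1)])
    fix i assume i: "i \<in> I"
    have "(\<lambda>g. g i) \<in> PiM J M \<rightarrow>\<^sub>M config_space"
      using i I(2) by (subst measurable_cong_sets[OF refl M[OF i, symmetric]]) (auto intro: measurable_component_singleton)
    then show "(\<lambda>g. emeasure (g i) B) \<in> borel_measurable (PiM J M)"
      by (rule measurable_compose) (rule measurable_config_count[OF B])
  qed
  then show "(\<lambda>g. emeasure (superpose I g) B) \<in> borel_measurable (PiM J M)"
    by (subst measurable_cong[where g="\<lambda>g. \<integral>\<^sup>+i. emeasure (g i) B \<partial>count_space I"])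
      (auto intro!: emeasure_superpose[OF I(1)] simp: sp B)
qed

section \<open>Laplace functionals\<close>

text \<open>The exponential \<open>exp (- t)\<close> on [0, \<infinity>]. The infinite value is set
  by hand, since \<open>enn2real\<close> sends \<infinity> to 0.\<close>

definition expneg :: "ennreal \<Rightarrow> real" where
  "expneg t = (if t = \<infinity> then 0 else exp (- enn2real t))"

text \<open>Inverse of \<open>expneg\<close> on [0, 1]. The value \<infinity> at 0 is attained by
  Laplace transforms of clusters that almost surely put infinitely many points into a test
  set.\<close>

definition neglog :: "real \<Rightarrow> ennreal" where
  "neglog p = (if p \<le> 0 then \<infinity> else ennreal (- ln p))"

lemma expneg_bounds: "0 \<le> expneg t" "expneg t \<le> 1"
  by (auto simp: expneg_def)

lemma expneg_0 [simp]: "expneg 0 = 1"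
  by (simp add: expneg_def)

lemma expneg_add: "expneg (s + t) = expneg s * expneg t"
  by (auto simp: expneg_def enn2real_plus less_top exp_add[symmetric])

lemma expneg_sum: "expneg (\<Sum>i\<in>A. f i) = (\<Prod>i\<in>A. expneg (f i))"
  by (induction A rule: infinite_finite_induct) (auto simp: expneg_add)

lemma expneg_measurable [measurable]: "expneg \<in> borel_measurable borel"
  unfolding expneg_def by measurable

lemma neglog_measurable [measurable]: "neglog \<in> borel_measurable borel"
  unfolding neglog_def by measurable

lemma expneg_neglog: "0 \<le> p \<Longrightarrow> p \<le> 1 \<Longrightarrow> expneg (neglog p) = p"
  by (auto simp: expneg_def neglog_def)

lemma expneg_inj: "expneg s = expneg t \<Longrightarrow> s = t"
  by (cases s; cases t) (auto simp: expneg_def split: if_splits)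

text \<open>The limit \<infinity> has to be included, because partial sums of counts may
  diverge.\<close>

lemma tendsto_expneg:
  assumes "(f \<longlongrightarrow> t) F"
  shows "((\<lambda>x. expneg (f x)) \<longlongrightarrow> expneg t) F"
proof (cases "t = \<infinity>")
  case True
  have "((\<lambda>x. expneg (f x)) \<longlongrightarrow> 0) F"
  proof (rule tendstoI)
    fix e :: real assume "0 < e"
    have "\<forall>\<^sub>F x in F. ennreal (\<bar>ln e\<bar>) < f x"
      using assms True by (intro order_tendstoD(1)) auto
    then show "\<forall>\<^sub>F x in F. dist (expneg (f x)) 0 < e"
    proof eventually_elim
      case (elim x)
      show ?case
      proof (cases "f x")
        case (real r)
        with elim have "- r < ln e" by (auto simp: ennreal_less_iff)
        then have "exp (- r) < e" using \<open>0 < e\<close> by (metis exp_less_mono exp_ln)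
        then show ?thesis using real by (simp add: expneg_def)
      qed (use \<open>0 < e\<close> in \<open>simp add: expneg_def\<close>)
    qed
  qed
  then show ?thesis using True by (simp add: expneg_def)
next
  case False
  then obtain r where r: "t = ennreal r" "0 \<le> r" by (cases t) auto
  have "\<forall>\<^sub>F x in F. f x < \<infinity>"
    using assms False by (intro order_tendstoD(2)) (auto simp: less_top)
  then have "\<forall>\<^sub>F x in F. exp (- enn2real (f x)) = expneg (f x)"
    by eventually_elim (auto simp: expneg_def)
  moreover have "((\<lambda>x. exp (- enn2real (f x))) \<longlongrightarrow> exp (- r)) F"
    using assms r by (intro tendsto_intros) auto
  ultimately have "((\<lambda>x. expneg (f x)) \<longlongrightarrow> exp (- r)) F"
    by (rule Lim_transform_eventually[rotated])
  then show ?thesis using r by (simp add: expneg_def)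
qed

text \<open>Independence gives the product formula for finitely many coordinates. Truncated sums
  increase to the full sum and all integrands are bounded by 1, so dominated convergence reaches
  countable \<open>I\<close>. Taking \<open>neglog\<close> of each factor replaces an infinite
  product by a sum in [0, \<infinity>].\<close>

lemma integral_expneg_PiM:
  assumes I: "countable I" and P: "\<And>i. prob_space (P i)"
    and T: "\<And>i. i \<in> I \<Longrightarrow> T i \<in> borel_measurable (P i)"
  shows "(\<integral>g. expneg (\<integral>\<^sup>+i. T i (g i) \<partial>count_space I) \<partial>PiM I P)
       = expneg (\<integral>\<^sup>+i. neglog (\<integral>y. expneg (T i y) \<partial>P i) \<partial>count_space I)"
proof -
  interpret P: product_prob_space P I
    by (rule product_prob_spaceI) (rule P)
  let ?F = "\<lambda>n. {i\<in>I. to_nat_on I i < n}"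
  have finF: "finite (?F n)" for n
    using I by (rule finite_to_nat_on_less)
  have Tm: "(\<lambda>g. T i (g i)) \<in> borel_measurable (PiM I P)" if "i \<in> I" for i
    using T[OF that] that by measurable
  have intT: "integrable (P i) (\<lambda>y. expneg (T i y))" if "i \<in> I" for i
    using T[OF that]
    by (intro finite_measure.integrable_const_bound[OF prob_space.finite_measure[OF P], where B=1])
      (auto simp: expneg_bounds)
  have phi: "0 \<le> (\<integral>y. expneg (T i y) \<partial>P i)" "(\<integral>y. expneg (T i y) \<partial>P i) \<le> 1" if "i \<in> I" for i
  proof -
    show "0 \<le> (\<integral>y. expneg (T i y) \<partial>P i)" by (simp add: expneg_bounds)
    show "(\<integral>y. expneg (T i y) \<partial>P i) \<le> 1"
      using intT[OF that] by (intro prob_space.integral_le_const[OF P]) (auto simp: expneg_bounds)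
  qed
  have fin: "(\<integral>g. expneg (\<Sum>i\<in>J. T i (g i)) \<partial>PiM I P)
      = expneg (\<Sum>i\<in>J. neglog (\<integral>y. expneg (T i y) \<partial>P i))" if J: "finite J" "J \<subseteq> I" for J
  proof -
    have "(\<integral>g. expneg (\<Sum>i\<in>J. T i (g i)) \<partial>PiM I P) = (\<integral>g. (\<Prod>i\<in>J. expneg (T i (restrict g J i))) \<partial>PiM I P)"
      by (simp add: expneg_sum)
    \<comment> \<open>The integrand sees only the coordinates in \<open>J\<close>, so the integral
      is moved to the finite product, where it factorises.\<close>
    also have "\<dots> = (\<integral>g. (\<Prod>i\<in>J. expneg (T i (g i))) \<partial>distr (PiM I P) (PiM J P) (\<lambda>g. restrict g J))"
    proof (rule integral_distr[symmetric])
      show "(\<lambda>g. restrict g J) \<in> PiM I P \<rightarrow>\<^sub>M PiM J P" using J by (rule_tac measurable_restrict_subset)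
      have "(\<lambda>g. expneg (T i (g i))) \<in> borel_measurable (PiM J P)" if "i \<in> J" for i
        using T[of i] that J
        by (intro measurable_compose[OF measurable_compose[OF measurable_component_singleton[of i J] T] expneg_measurable]) auto
      then show "(\<lambda>g. \<Prod>i\<in>J. expneg (T i (g i))) \<in> borel_measurable (PiM J P)"
        by (rule borel_measurable_prod)
    qed
    also have "\<dots> = (\<integral>g. (\<Prod>i\<in>J. expneg (T i (g i))) \<partial>PiM J P)"
      using J by (simp add: P.distr_PiM_restrict_finite)
    also have "\<dots> = (\<Prod>i\<in>J. \<integral>y. expneg (T i y) \<partial>P i)"
      using J intT by (intro P.product_integral_prod) auto
    also have "\<dots> = expneg (\<Sum>i\<in>J. neglog (\<integral>y. expneg (T i y) \<partial>P i))"
      unfolding expneg_sum using J phi by (intro prod.cong) (auto simp: expneg_neglog)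
    finally show ?thesis .
  qed
  have "(\<lambda>n. \<integral>g. expneg (\<Sum>i\<in>?F n. T i (g i)) \<partial>PiM I P)
      \<longlonglongrightarrow> (\<integral>g. expneg (\<integral>\<^sup>+i. T i (g i) \<partial>count_space I) \<partial>PiM I P)"
  proof (rule integral_dominated_convergence[where w="\<lambda>_. 1"])
    show "AE g in PiM I P. (\<lambda>n. expneg (\<Sum>i\<in>?F n. T i (g i)))
        \<longlonglongrightarrow> expneg (\<integral>\<^sup>+i. T i (g i) \<partial>count_space I)"
      by (intro AE_I2 tendsto_expneg nn_integral_count_space_countable[OF I])
    show "(\<lambda>g. expneg (\<integral>\<^sup>+i. T i (g i) \<partial>count_space I)) \<in> borel_measurable (PiM I P)"
      by (rule measurable_compose[OF borel_measurable_nn_integral_count_space[OF I Tm] expneg_measurable])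
    show "(\<lambda>g. expneg (\<Sum>i\<in>?F n. T i (g i))) \<in> borel_measurable (PiM I P)" for n
      by (rule measurable_compose[OF borel_measurable_sum expneg_measurable]) (auto intro: Tm)
  qed (auto simp: expneg_bounds)
  moreover have "(\<lambda>n. expneg (\<Sum>i\<in>?F n. neglog (\<integral>y. expneg (T i y) \<partial>P i)))
      \<longlonglongrightarrow> expneg (\<integral>\<^sup>+i. neglog (\<integral>y. expneg (T i y) \<partial>P i) \<partial>count_space I)"
    by (intro tendsto_expneg nn_integral_count_space_countable[OF I])
  moreover have "(\<integral>g. expneg (\<Sum>i\<in>?F n. T i (g i)) \<partial>PiM I P)
      = expneg (\<Sum>i\<in>?F n. neglog (\<integral>y. expneg (T i y) \<partial>P i))" for n
    by (rule fin[OF finF]) auto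
  ultimately show ?thesis by (simp add: LIMSEQ_unique)
qed

text \<open>The pi-system of finite intersections of generators. Building it one condition at a time
  lets a property of indicators be proved by multiplying in one factor per step.\<close>

inductive_set count_cylinders :: "'a::topological_space measure set set" where
  whole: "generalised_configs \<in> count_cylinders"
| cut: "A \<in> count_cylinders \<Longrightarrow> B \<in> sets borel \<Longrightarrow>
    A \<inter> {\<gamma>\<in>generalised_configs. emeasure \<gamma> B = of_nat n} \<in> count_cylinders"

lemma count_cylinders_subset: "A \<in> count_cylinders \<Longrightarrow> A \<subseteq> generalised_configs"
  by (induction rule: count_cylinders.induct) auto

lemma count_cylinders_sets: "A \<in> count_cylinders \<Longrightarrow> A \<in> sets config_space"
proof (induction rule: count_cylinders.induct)
  case whole
  then show ?case using sets.top[of config_space] by simp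
next
  case (cut A B n)
  from cut.hyps(2) have "{\<gamma>\<in>space config_space. emeasure \<gamma> B = of_nat n} \<in> sets config_space"
    by measurable
  with cut.IH show ?case by (simp add: sets.Int)
qed

lemma Int_stable_count_cylinders: "Int_stable count_cylinders"
proof (rule Int_stableI)
  fix A B :: "'a measure set"
  assume "B \<in> count_cylinders" and A: "A \<in> count_cylinders"
  then show "A \<inter> B \<in> count_cylinders"
  proof (induction rule: count_cylinders.induct)
    case whole
    then show ?case using count_cylinders_subset[OF A] A by (simp add: Int_absorb2)
  next
    case (cut C B n)
    from count_cylinders.cut[OF cut.IH[OF A] cut.hyps(2), of n] show ?case by (simp only: Int_assoc)
  qed
qed

lemma sets_config_space_cylinders:
  "sets (config_space :: 'a::topological_space measure measure) = sigma_sets generalised_configs count_cylinders"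
proof
  have "{\<gamma>\<in>generalised_configs. emeasure \<gamma> B = of_nat n} \<in> sigma_sets generalised_configs count_cylinders"
    if "B \<in> sets borel" for B :: "'a set" and n
  proof -
    have "generalised_configs \<inter> {\<gamma>\<in>generalised_configs. emeasure \<gamma> B = of_nat n}
        = {\<gamma>\<in>generalised_configs. emeasure \<gamma> B = of_nat n}" by blast
    with count_cylinders.cut[OF count_cylinders.whole that, of n] show ?thesis
      by (simp add: sigma_sets.Basic)
  qed
  then show "sets (config_space :: 'a measure measure) \<subseteq> sigma_sets generalised_configs count_cylinders"
    unfolding sets_config_space by (intro sigma_sets_mono subsetI) (elim CollectE exE conjE, simp)
  show "sigma_sets generalised_configs count_cylinders \<subseteq> sets config_space"
    using sets.sigma_sets_subset[of count_cylinders config_space] count_cylinders_sets by auto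
qed

text \<open>The indicator of \<open>\<xi> B = n\<close> is the pointwise limit of \<open>(1 - (z - exp (- n))\<^sup>2) ^ k\<close> with
  \<open>z = exp (- \<xi> B)\<close>, so that the Laplace functionals determine the measurability of the kernel.\<close>

lemma measurable_kernel_laplace:
  fixes K :: "'b \<Rightarrow> 'a::topological_space measure measure"
  assumes prob: "\<And>\<omega>. \<omega> \<in> space M \<Longrightarrow> prob_space (K \<omega>)"
    and sets: "\<And>\<omega>. \<omega> \<in> space M \<Longrightarrow> sets (K \<omega>) = sets config_space"
    and lap: "\<And>bs. set bs \<subseteq> sets borel \<Longrightarrow>
      (\<lambda>\<omega>. \<integral>\<xi>. expneg (\<Sum>B\<leftarrow>bs. emeasure \<xi> B) \<partial>K \<omega>) \<in> borel_measurable M"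
  shows "K \<in> M \<rightarrow>\<^sub>M prob_algebra config_space"
proof -
  \<comment> \<open>Bounded test functions whose integrals against every Laplace exponential are
    measurable in the parameter. Keeping the exponentials as an extra factor makes the class stable
    under multiplication by \<open>expneg (emeasure \<xi> B)\<close>: this only prepends
    \<open>B\<close> to the list.\<close>
  define C :: "('a measure \<Rightarrow> real) \<Rightarrow> bool" where
    "C f \<longleftrightarrow> f \<in> borel_measurable config_space \<and> (\<exists>b. \<forall>\<xi>. \<bar>f \<xi>\<bar> \<le> b) \<and>
      (\<forall>bs. set bs \<subseteq> sets borel \<longrightarrow>
        (\<lambda>\<omega>. \<integral>\<xi>. f \<xi> * expneg (\<Sum>B\<leftarrow>bs. emeasure \<xi> B) \<partial>K \<omega>) \<in> borel_measurable M)" for f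
  have Em[measurable]: "(\<lambda>\<xi>. expneg (\<Sum>B\<leftarrow>bs. emeasure \<xi> B)) \<in> borel_measurable config_space"
    if "set bs \<subseteq> sets borel" for bs :: "'a set list"
    by (rule measurable_compose[OF measurable_config_sum_list[OF that] expneg_measurable])
  have bK: "f \<in> borel_measurable (K \<omega>)" if "f \<in> borel_measurable config_space" "\<omega> \<in> space M"
    for f :: "'a measure \<Rightarrow> real" and \<omega>
    using that by (simp add: measurable_cong_sets[OF sets refl])
  have int: "integrable (K \<omega>) (\<lambda>\<xi>. f \<xi> * expneg (\<Sum>B\<leftarrow>bs. emeasure \<xi> B))"
    if f: "f \<in> borel_measurable config_space" "\<And>\<xi>. \<bar>f \<xi>\<bar> \<le> b" and \<omega>: "\<omega> \<in> space M"
      and bs: "set bs \<subseteq> sets borel" for f b \<omega> bs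
  proof -
    interpret prob_space "K \<omega>" using prob[OF \<omega>] .
    have "(\<lambda>\<xi>. f \<xi> * expneg (\<Sum>B\<leftarrow>bs. emeasure \<xi> B)) \<in> borel_measurable config_space"
      using f Em[OF bs] by measurable
    moreover have "\<bar>f \<xi>\<bar> * expneg t \<le> b" for \<xi> t
      using mult_mono[OF f(2)[of \<xi>] expneg_bounds(2)[of t]] f(2)[of \<xi>] expneg_bounds[of t] by simp
    ultimately show ?thesis
      using \<omega> by (intro integrable_const_bound[where B=b] bK)
        (auto simp: abs_mult expneg_bounds)
  qed
  have C1: "C (\<lambda>_. 1)"
    unfolding C_def using lap by (auto intro: exI[of _ 1])
  have Clin: "C (\<lambda>\<xi>. a * f \<xi> + c * g \<xi>)" if f: "C f" and g: "C g" for f g a c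
  proof -
    from f obtain b where b: "\<And>\<xi>. \<bar>f \<xi>\<bar> \<le> b" unfolding C_def by blast
    from g obtain d where d: "\<And>\<xi>. \<bar>g \<xi>\<bar> \<le> d" unfolding C_def by blast
    have "\<bar>a * f \<xi> + c * g \<xi>\<bar> \<le> \<bar>a\<bar> * b + \<bar>c\<bar> * d" for \<xi>
      using mult_left_mono[OF b[of \<xi>], of "\<bar>a\<bar>"] mult_left_mono[OF d[of \<xi>], of "\<bar>c\<bar>"]
      by (simp add: abs_mult[symmetric])
    moreover have "(\<lambda>\<omega>. \<integral>\<xi>. (a * f \<xi> + c * g \<xi>) * expneg (\<Sum>B\<leftarrow>bs. emeasure \<xi> B) \<partial>K \<omega>) \<in> borel_measurable M"
      if bs: "set bs \<subseteq> sets borel" for bs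
    proof -
      let ?E = "\<lambda>\<xi>. expneg (\<Sum>B\<leftarrow>bs. emeasure \<xi> B)"
      have eq: "(\<integral>\<xi>. (a * f \<xi> + c * g \<xi>) * ?E \<xi> \<partial>K \<omega>) = a * (\<integral>\<xi>. f \<xi> * ?E \<xi> \<partial>K \<omega>) + c * (\<integral>\<xi>. g \<xi> * ?E \<xi> \<partial>K \<omega>)"
        if "\<omega> \<in> space M" for \<omega>
      proof -
        have "integrable (K \<omega>) (\<lambda>\<xi>. f \<xi> * ?E \<xi>)" "integrable (K \<omega>) (\<lambda>\<xi>. g \<xi> * ?E \<xi>)"
          using f g b d that bs by (auto intro!: int simp: C_def)
        then show ?thesis by (simp add: distrib_right mult.assoc)
      qed
      have "(\<lambda>\<omega>. a * (\<integral>\<xi>. f \<xi> * ?E \<xi> \<partial>K \<omega>) + c * (\<integral>\<xi>. g \<xi> * ?E \<xi> \<partial>K \<omega>)) \<in> borel_measurable M"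
        using f g bs unfolding C_def
        by (intro borel_measurable_add borel_measurable_times borel_measurable_const) auto
      moreover have "(\<lambda>\<omega>. \<integral>\<xi>. (a * f \<xi> + c * g \<xi>) * ?E \<xi> \<partial>K \<omega>) \<in> borel_measurable M \<longleftrightarrow>
        (\<lambda>\<omega>. a * (\<integral>\<xi>. f \<xi> * ?E \<xi> \<partial>K \<omega>) + c * (\<integral>\<xi>. g \<xi> * ?E \<xi> \<partial>K \<omega>)) \<in> borel_measurable M"
        by (rule measurable_cong) (rule eq)
      ultimately show ?thesis by blast
    qed
    ultimately show ?thesis using f g unfolding C_def by auto
  qed
  have Cmult: "C (\<lambda>\<xi>. f \<xi> * expneg (emeasure \<xi> B))" if f: "C f" and B: "B \<in> sets borel" for f B
  proof -
    from f obtain b where b: "\<And>\<xi>. \<bar>f \<xi>\<bar> \<le> b" unfolding C_def by blast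
    have "\<bar>f \<xi> * expneg t\<bar> \<le> b" for \<xi> t
      using mult_mono[OF b[of \<xi>] expneg_bounds(2)[of t]] b[of \<xi>] expneg_bounds[of t] by (simp add: abs_mult)
    moreover have "(\<lambda>\<xi>. f \<xi> * expneg (emeasure \<xi> B)) \<in> borel_measurable config_space"
      using f Em[of "[B]"] B unfolding C_def by (auto intro!: borel_measurable_times)
    moreover have "(\<lambda>\<omega>. \<integral>\<xi>. f \<xi> * expneg (emeasure \<xi> B) * expneg (\<Sum>B\<leftarrow>bs. emeasure \<xi> B) \<partial>K \<omega>)
        \<in> borel_measurable M" if "set bs \<subseteq> sets borel" for bs
      using f B that unfolding C_def
      by (elim conjE allE[of _ "B # bs"]) (simp add: expneg_add mult.assoc)
    ultimately show ?thesis unfolding C_def by blast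
  qed
  have Ccut: "C (\<lambda>\<xi>. f \<xi> * of_bool (emeasure \<xi> B = of_nat n))" if f: "C f" and B: "B \<in> sets borel" for f B n
  proof -
    define a where "a = expneg (of_nat n)"
    \<comment> \<open>Both exponentials lie in [0, 1] and \<open>expneg\<close> is injective, so
      \<open>q\<close> has values in [0, 1] and equals 1 exactly where the count is
      \<open>n\<close>. It is a polynomial in the exponential, hence multiplication by it stays in
      the class.\<close>
    define q where "q \<xi> = 1 - (expneg (emeasure \<xi> B) - a)\<^sup>2" for \<xi> :: "'a measure"
    have q: "0 \<le> q \<xi>" "q \<xi> \<le> 1" "emeasure \<xi> B = of_nat n \<Longrightarrow> q \<xi> = 1" "emeasure \<xi> B \<noteq> of_nat n \<Longrightarrow> q \<xi> < 1" for \<xi>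
    proof -
      have "\<bar>expneg (emeasure \<xi> B) - a\<bar> \<le> 1"
        unfolding a_def using expneg_bounds[of "emeasure \<xi> B"] expneg_bounds[of "of_nat n"] by linarith
      then show "0 \<le> q \<xi>" by (simp add: q_def abs_square_le_1)
      show "emeasure \<xi> B \<noteq> of_nat n \<Longrightarrow> q \<xi> < 1"
        using expneg_inj[of "emeasure \<xi> B" "of_nat n"] by (auto simp: q_def a_def)
    qed (auto simp: q_def a_def)
    have Cq: "C (\<lambda>\<xi>. f \<xi> * q \<xi>)" if f: "C f" for f
    proof -
      let ?z = "\<lambda>\<xi>. expneg (emeasure \<xi> B)"
      \<comment> \<open>The expansion 1 - (z - a)^2 = (1 - a^2) + 2az - z^2, arranged as two nested
        linear combinations to fit \<open>Clin\<close>.\<close>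
      have "C (\<lambda>\<xi>. 1 * ((1 - a\<^sup>2) * f \<xi> + 2 * a * (f \<xi> * ?z \<xi>)) + - 1 * (f \<xi> * ?z \<xi> * ?z \<xi>))"
        by (intro Clin Cmult B f)
      also have "(\<lambda>\<xi>. 1 * ((1 - a\<^sup>2) * f \<xi> + 2 * a * (f \<xi> * ?z \<xi>)) + - 1 * (f \<xi> * ?z \<xi> * ?z \<xi>)) = (\<lambda>\<xi>. f \<xi> * q \<xi>)"
        unfolding q_def by (rule ext) (simp add: power2_eq_square algebra_simps)
      finally show ?thesis .
    qed
    have Cpow: "C (\<lambda>\<xi>. f \<xi> * q \<xi> ^ k)" for k
    proof (induction k)
      case (Suc k)
      from Cq[OF this] show ?case by (simp add: ac_simps)
    qed (use f in simp)
    from f obtain b where b: "\<And>\<xi>. \<bar>f \<xi>\<bar> \<le> b" unfolding C_def by blast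
    have lim: "(\<lambda>k. f \<xi> * q \<xi> ^ k * c) \<longlonglongrightarrow> f \<xi> * of_bool (emeasure \<xi> B = of_nat n) * c" for \<xi> c
    proof (cases "emeasure \<xi> B = of_nat n")
      case False
      have "(\<lambda>k. f \<xi> * q \<xi> ^ k * c) \<longlonglongrightarrow> f \<xi> * 0 * c"
        using q[of \<xi>] False by (intro tendsto_intros LIMSEQ_power_zero) auto
      then show ?thesis using False by simp
    qed (use q in simp)
    have meas: "(\<lambda>\<xi>. f \<xi> * of_bool (emeasure \<xi> B = of_nat n)) \<in> borel_measurable config_space"
    proof (rule borel_measurable_LIMSEQ_real[where u="\<lambda>k \<xi>. f \<xi> * q \<xi> ^ k"])
      show "(\<lambda>\<xi>. f \<xi> * q \<xi> ^ k) \<in> borel_measurable config_space" for k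
        using Cpow[of k] unfolding C_def by blast
      show "(\<lambda>k. f \<xi> * q \<xi> ^ k) \<longlonglongrightarrow> f \<xi> * of_bool (emeasure \<xi> B = of_nat n)" for \<xi>
        using lim[of \<xi> 1] by simp
    qed
    have bd: "\<bar>f \<xi> * of_bool (emeasure \<xi> B = of_nat n)\<bar> \<le> b" for \<xi>
      using b[of \<xi>] abs_ge_zero[of "f \<xi>"] by (cases "emeasure \<xi> B = of_nat n") (simp_all del: abs_ge_zero)
    have "(\<lambda>\<omega>. \<integral>\<xi>. f \<xi> * of_bool (emeasure \<xi> B = of_nat n) * expneg (\<Sum>B\<leftarrow>bs. emeasure \<xi> B) \<partial>K \<omega>)
        \<in> borel_measurable M" if bs: "set bs \<subseteq> sets borel" for bs
    proof (rule borel_measurable_LIMSEQ_real)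
      let ?E = "\<lambda>\<xi>. expneg (\<Sum>B\<leftarrow>bs. emeasure \<xi> B)"
      show "(\<lambda>\<omega>. \<integral>\<xi>. f \<xi> * q \<xi> ^ k * ?E \<xi> \<partial>K \<omega>) \<in> borel_measurable M" for k
        using Cpow bs unfolding C_def by blast
      fix \<omega> assume \<omega>: "\<omega> \<in> space M"
      interpret prob_space "K \<omega>" using prob[OF \<omega>] .
      show "(\<lambda>k. \<integral>\<xi>. f \<xi> * q \<xi> ^ k * ?E \<xi> \<partial>K \<omega>)
          \<longlonglongrightarrow> (\<integral>\<xi>. f \<xi> * of_bool (emeasure \<xi> B = of_nat n) * ?E \<xi> \<partial>K \<omega>)"
      proof (rule integral_dominated_convergence[where w="\<lambda>_. b"])
        show "AE \<xi> in K \<omega>. (\<lambda>k. f \<xi> * q \<xi> ^ k * ?E \<xi>) \<longlonglongrightarrow> f \<xi> * of_bool (emeasure \<xi> B = of_nat n) * ?E \<xi>"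
          by (intro AE_I2 lim)
        show "(\<lambda>\<xi>. f \<xi> * of_bool (emeasure \<xi> B = of_nat n) * ?E \<xi>) \<in> borel_measurable (K \<omega>)"
          by (rule bK[OF borel_measurable_times[OF meas Em[OF bs]] \<omega>])
        show "(\<lambda>\<xi>. f \<xi> * q \<xi> ^ k * ?E \<xi>) \<in> borel_measurable (K \<omega>)" for k
        proof (rule bK[OF borel_measurable_times[OF _ Em[OF bs]] \<omega>])
          show "(\<lambda>\<xi>. f \<xi> * q \<xi> ^ k) \<in> borel_measurable config_space"
            using Cpow[of k] unfolding C_def by blast
        qed
        have "\<bar>f \<xi>\<bar> * (q \<xi> ^ k * ?E \<xi>) \<le> b * 1" for \<xi> k
          using b[of \<xi>] q[of \<xi>] expneg_bounds
          by (intro mult_mono mult_le_one power_le_one) auto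
        then show "AE \<xi> in K \<omega>. norm (f \<xi> * q \<xi> ^ k * ?E \<xi>) \<le> b" for k
          using q expneg_bounds by (intro AE_I2) (simp add: abs_mult mult.assoc)
      qed simp
    qed
    with meas bd show ?thesis unfolding C_def by blast
  qed
  have Ccyl: "C (\<lambda>\<xi>. indicator A \<xi>)" if "A \<in> count_cylinders" for A :: "'a measure set"
    using that
  proof (induction rule: count_cylinders.induct)
    case whole
    have m: "indicator generalised_configs \<in> borel_measurable (config_space :: 'a measure measure)"
      by (rule borel_measurable_indicator[OF count_cylinders_sets[OF count_cylinders.whole]])
    \<comment> \<open>This indicator differs from the constant 1 outside the space of
      \<open>K \<omega>\<close>, so \<open>C1\<close> does not apply literally; under the integral
      the two agree.\<close>
    have "(\<lambda>\<omega>. \<integral>\<xi>. indicator generalised_configs \<xi> * expneg (\<Sum>B\<leftarrow>bs. emeasure \<xi> B) \<partial>K \<omega>)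
        \<in> borel_measurable M" if "set bs \<subseteq> sets borel" for bs
      using lap[OF that] sets_eq_imp_space_eq[OF sets]
      by (subst measurable_cong[where g="\<lambda>\<omega>. \<integral>\<xi>. expneg (\<Sum>B\<leftarrow>bs. emeasure \<xi> B) \<partial>K \<omega>"])
        (auto intro!: Bochner_Integration.integral_cong)
    with m show ?case unfolding C_def by (auto intro!: exI[of _ 1])
  next
    case (cut A B n)
    have "indicator (A \<inter> {\<gamma>\<in>generalised_configs. emeasure \<gamma> B = of_nat n}) \<xi>
      = indicator A \<xi> * (of_bool (emeasure \<xi> B = of_nat n) :: real)" for \<xi>
      using count_cylinders_subset[OF cut.hyps(1)] by (auto simp: indicator_def)
    then show ?case using Ccut[OF cut.IH cut.hyps(2)] by simp
  qed
  show ?thesis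
  proof (rule measurable_prob_algebra_generated[OF sets_config_space_cylinders Int_stable_count_cylinders])
    fix A :: "'a measure set" assume A: "A \<in> count_cylinders"
    have "(\<lambda>\<omega>. \<integral>\<xi>. indicat_real A \<xi> \<partial>K \<omega>) \<in> borel_measurable M"
    proof -
      have "(\<lambda>\<omega>. \<integral>\<xi>. indicat_real A \<xi> * expneg (\<Sum>B\<leftarrow>[]. emeasure \<xi> B) \<partial>K \<omega>) \<in> borel_measurable M"
        using Ccyl[OF A] unfolding C_def by (elim conjE) (drule spec[of _ "[]"], simp)
      then show ?thesis by simp
    qed
    then have "(\<lambda>\<omega>. ennreal (\<integral>\<xi>. indicat_real A \<xi> \<partial>K \<omega>)) \<in> borel_measurable M"
      by (rule measurable_compose) measurable
    also have "(\<lambda>\<omega>. ennreal (\<integral>\<xi>. indicat_real A \<xi> \<partial>K \<omega>)) \<in> borel_measurable M \<longleftrightarrow>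
        (\<lambda>\<omega>. emeasure (K \<omega>) A) \<in> borel_measurable M"
    proof (rule measurable_cong)
      fix \<omega> assume \<omega>: "\<omega> \<in> space M"
      interpret prob_space "K \<omega>" using prob[OF \<omega>] .
      show "ennreal (\<integral>\<xi>. indicat_real A \<xi> \<partial>K \<omega>) = emeasure (K \<omega>) A"
        using count_cylinders_sets[OF A] sets[OF \<omega>] by (simp add: emeasure_eq_measure)
    qed
    finally show "(\<lambda>\<omega>. emeasure (K \<omega>) A) \<in> borel_measurable M" .
  qed (use count_cylinders_subset prob sets in auto)
qed

section \<open>Locally finite configurations\<close>

lemma dense_sequence:
  obtains q :: "nat \<Rightarrow> 'a::second_countable_topology"
  where "\<And>U. open U \<Longrightarrow> U \<noteq> {} \<Longrightarrow> \<exists>i. q i \<in> U"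
proof -
  obtain D :: "'a set" where D: "countable D" "\<And>U. open U \<Longrightarrow> U \<noteq> {} \<Longrightarrow> \<exists>d\<in>D. d \<in> U"
    by (rule countable_dense_setE) blast
  show thesis
  proof (rule that)
    fix U :: "'a set" assume "open U" "U \<noteq> {}"
    from D(2)[OF this] obtain d where d: "d \<in> D" "d \<in> U" by blast
    with from_nat_into_surj[OF D(1) d(1)] show "\<exists>i. from_nat_into D i \<in> U" by auto
  qed
qed

text \<open>For each \<open>e\<close>, all but finitely many \<open>C m\<close> lie in a set
  \<open>V m\<close> with a finite \<open>e\<close>-net, and the remaining ones are compact. The
  union is therefore totally bounded, and in a complete space its closure is compact.\<close>

lemma compact_closure_shrinking:
  fixes C :: "nat \<Rightarrow> 'a::complete_space set"
  assumes C: "\<And>m. compact (C m)" "\<And>m. C m \<subseteq> V m"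
    and V: "decseq V"
    and cov: "\<And>e. 0 < e \<Longrightarrow> \<exists>m F. finite F \<and> V m \<subseteq> (\<Union>x\<in>F. ball x e)"
  shows "compact (closure (\<Union>m. C m))"
  unfolding compact_eq_totally_bounded
proof (intro conjI allI impI)
  show "Topological_Spaces.complete (closure (\<Union>m. C m))" by (simp add: complete_eq_closed)
  fix e :: real assume "0 < e"
  then obtain m F where F: "finite F" "V m \<subseteq> (\<Union>x\<in>F. ball x (e/2))" using cov[of "e/2"] by auto
  have "compact (\<Union>i<m. C i)" using C by (intro compact_UN) auto
  then obtain G where G: "finite G" "(\<Union>i<m. C i) \<subseteq> (\<Union>x\<in>G. ball x (e/2))"
    unfolding compact_eq_totally_bounded using \<open>0 < e\<close> half_gt_zero by blast
  have "C i \<subseteq> (\<Union>x\<in>F \<union> G. ball x (e/2))" for i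
  proof (cases "i < m")
    case False
    then have "C i \<subseteq> V m" using C(2)[of i] decseqD[OF V, of m i] by auto
    then show ?thesis using F by auto
  qed (use G in auto)
  \<comment> \<open>A finite union of closed balls is closed and absorbs the closure; half the
    radius leaves room to return to open balls of radius \<open>e\<close>.\<close>
  then have "(\<Union>i. C i) \<subseteq> (\<Union>x\<in>F \<union> G. cball x (e/2))"
    using ball_subset_cball by blast
  then have "closure (\<Union>i. C i) \<subseteq> (\<Union>x\<in>F \<union> G. cball x (e/2))"
    using F(1) G(1) by (intro closure_minimal closed_UN) auto
  also have "\<dots> \<subseteq> (\<Union>x\<in>F \<union> G. ball x e)"
  proof -
    have "cball x (e/2) \<subseteq> ball x e" for x :: 'a using \<open>0 < e\<close> by auto
    then show ?thesis by blast
  qed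
  finally show "\<exists>k. finite k \<and> closure (\<Union>i. C i) \<subseteq> (\<Union>x\<in>k. ball x e)"
    using F(1) G(1) by blast
qed

text \<open>If every neighbourhood of \<open>z\<close> has infinite mass, finite sets of mass at
  least \<open>m\<close> can be chosen within distance \<open>(1/2) ^ m\<close> of \<open>z\<close>;
  the closure of their union is compact and has infinite mass. Conversely, a compact set has a
  finite cover by open sets of finite mass. No local compactness enters.\<close>

lemma locally_finite_iff:
  fixes \<gamma> :: "'a::complete_space measure"
  assumes \<gamma>: "\<gamma> \<in> generalised_configs"
  shows "locally_finite_config \<gamma> \<longleftrightarrow> (\<forall>x. \<exists>U. open U \<and> x \<in> U \<and> emeasure \<gamma> U < \<infinity>)"
proof
  assume lf: "locally_finite_config \<gamma>"
  show "\<forall>x. \<exists>U. open U \<and> x \<in> U \<and> emeasure \<gamma> U < \<infinity>"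
  proof (rule ccontr)
    assume "\<not> (\<forall>x. \<exists>U. open U \<and> x \<in> U \<and> emeasure \<gamma> U < \<infinity>)"
    then obtain z where "\<forall>U. open U \<and> z \<in> U \<longrightarrow> \<not> emeasure \<gamma> U < \<infinity>" by blast
    then have z: "\<And>U. open U \<Longrightarrow> z \<in> U \<Longrightarrow> emeasure \<gamma> U = \<infinity>" by (simp add: less_top[symmetric])
    from \<gamma> obtain I :: "nat set" and x where \<gamma>_eq: "\<gamma> = superpose I (\<lambda>i. return borel (x i))"
      by (rule generalised_configsE)
    let ?V = "\<lambda>m::nat. ball z ((1/2) ^ m)"
    have "\<exists>C. finite C \<and> C \<subseteq> ?V m \<and> of_nat m \<le> emeasure \<gamma> C" for m
    proof -
      have "emeasure (count_space I) {i\<in>I. x i \<in> ?V m} = \<infinity>"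
      proof -
        have "emeasure \<gamma> (?V m) = \<infinity>" by (rule z) auto
        then show ?thesis unfolding \<gamma>_eq by (subst (asm) emeasure_superpose_return) auto
      qed
      then have "infinite {i\<in>I. x i \<in> ?V m}" by (auto simp: emeasure_count_space_finite)
      \<comment> \<open>Indices are chosen instead of points, since the infinite mass may sit on a
        few multiple points.\<close>
      then obtain F where F: "F \<subseteq> {i\<in>I. x i \<in> ?V m}" "card F = m" "finite F"
        using infinite_arbitrarily_large by blast
      have "of_nat m = emeasure (count_space I) F"
        using F by (subst emeasure_count_space_finite) blast+
      also have "\<dots> \<le> emeasure (count_space I) {i\<in>I. x i \<in> x ` F}"
        using F by (intro emeasure_mono) auto
      also have "\<dots> = emeasure \<gamma> (x ` F)"
        unfolding \<gamma>_eq using F(3) by (subst emeasure_superpose_return) (simp_all add: borel_closed finite_imp_closed)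
      finally show ?thesis using F by (intro exI[of _ "x ` F"]) auto
    qed
    then obtain C where C: "\<And>m. finite (C m)" "\<And>m. C m \<subseteq> ?V m" "\<And>m. of_nat m \<le> emeasure \<gamma> (C m)"
      by metis
    let ?K = "closure (\<Union>m. C m)"
    have "compact ?K"
    proof (rule compact_closure_shrinking[where V="?V"])
      show "decseq ?V" by (intro decseq_SucI subset_ball) simp
      fix e :: real assume "0 < e"
      then obtain m where "(1/2) ^ m < e" using real_arch_pow_inv[of e "1/2"] by auto
      then show "\<exists>m F. finite F \<and> ?V m \<subseteq> (\<Union>x\<in>F. ball x e)"
        by (intro exI[of _ m] exI[of _ "{z}"]) auto
    qed (use C in \<open>auto intro: finite_imp_compact\<close>)
    then have "emeasure \<gamma> ?K < \<infinity>" using lf by (auto simp: locally_finite_config_def)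
    moreover have "of_nat m \<le> emeasure \<gamma> ?K" for m
    proof -
      have "emeasure \<gamma> (C m) \<le> emeasure \<gamma> ?K"
        using \<gamma> closure_subset[of "\<Union>m. C m"] by (intro emeasure_mono) auto
      with C(3)[of m] show ?thesis by simp
    qed
    moreover obtain m where "emeasure \<gamma> ?K < of_nat m"
      using \<open>emeasure \<gamma> ?K < \<infinity>\<close> ennreal_Ex_less_of_nat by auto
    ultimately show False using leD by blast
  qed
next
  assume *: "\<forall>x. \<exists>U. open U \<and> x \<in> U \<and> emeasure \<gamma> U < \<infinity>"
  then obtain U where U: "\<And>x. open (U x)" "\<And>x. x \<in> U x" "\<And>x. emeasure \<gamma> (U x) < \<infinity>" by metis
  show "locally_finite_config \<gamma>"
    unfolding locally_finite_config_def
  proof (intro allI impI)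
    fix K :: "'a set" assume "compact K"
    moreover have "K \<subseteq> (\<Union>x\<in>UNIV. U x)" using U(2) by blast
    ultimately obtain F where F: "finite F" "K \<subseteq> (\<Union>x\<in>F. U x)"
      using U(1) by (elim compactE_image) auto
    have "emeasure \<gamma> K \<le> emeasure \<gamma> (\<Union>x\<in>F. U x)"
      using F U(1) \<gamma> by (intro emeasure_mono) auto
    also have "\<dots> \<le> (\<Sum>x\<in>F. emeasure \<gamma> (U x))"
      using F(1) U(1) \<gamma> by (intro emeasure_subadditive_finite) auto
    also have "\<dots> < \<infinity>" using F(1) U(3) by (simp add: less_top)
    finally show "emeasure \<gamma> K < \<infinity>" .
  qed
qed

text \<open>By inner regularity, increasing compact sets exhaust \<open>V\<close> up to a \<nu>-null
  remainder, which almost every configuration avoids. Where the count of \<open>V\<close> is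
  infinite, the counts of these compact sets thus tend to infinity, and the events of still seeing
  fewer than \<open>m\<close> points decrease to a null set.\<close>

lemma inner_compact_configs:
  fixes M :: "'a::polish_space measure measure" and \<nu> :: "'a measure"
  assumes M: "finite_measure M" "sets M = sets config_space"
    and \<nu>: "finite_measure \<nu>" "sets \<nu> = sets borel"
    and ac: "\<And>A. A \<in> sets borel \<Longrightarrow> emeasure \<nu> A = 0 \<Longrightarrow> AE \<gamma> in M. emeasure \<gamma> A = 0"
    and V: "V \<in> sets borel" and e: "0 < e"
  obtains C where "compact C" "C \<subseteq> V"
    "emeasure M {\<gamma>\<in>generalised_configs. emeasure \<gamma> V = \<infinity> \<and> emeasure \<gamma> C < of_nat m} < e"
proof -
  interpret M: finite_measure M by fact
  interpret \<nu>: finite_measure \<nu> by fact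
  have "\<exists>K. compact K \<and> K \<subseteq> V \<and> measure \<nu> V - 1 / Suc l < measure \<nu> K" for l
  proof -
    have "ennreal (measure \<nu> V - 1 / Suc l) < emeasure \<nu> V" if "0 < measure \<nu> V"
      using that by (simp add: \<nu>.emeasure_eq_measure ennreal_less_iff) (simp add: ennreal_lessI)
    moreover have "emeasure \<nu> V = (SUP K \<in> {K. K \<subseteq> V \<and> compact K}. emeasure \<nu> K)"
      using V by (intro inner_regular \<nu>) auto
    ultimately have "\<exists>K. compact K \<and> K \<subseteq> V \<and> ennreal (measure \<nu> V - 1 / Suc l) < emeasure \<nu> K"
      if "0 < measure \<nu> V"
      using that by (auto simp: less_SUP_iff)
    then have "\<exists>K. compact K \<and> K \<subseteq> V \<and> measure \<nu> V - 1 / Suc l < measure \<nu> K" if "0 < measure \<nu> V"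
      using that by (metis \<nu>.emeasure_eq_measure ennreal_leI not_less)
    \<comment> \<open>Here \<open>ennreal\<close> truncates the negative left-hand side to 0 and the
      strict inequality is lost, so the empty set is taken directly.\<close>
    moreover have "\<exists>K. compact K \<and> K \<subseteq> V \<and> measure \<nu> V - 1 / Suc l < measure \<nu> K" if "measure \<nu> V = 0"
      using that by (intro exI[of _ "{}"]) auto
    ultimately show ?thesis by (metis zero_less_measure_iff measure_nonneg order_le_less)
  qed
  then obtain K where K: "\<And>l. compact (K l)" "\<And>l. K l \<subseteq> V" "\<And>l. measure \<nu> V - 1 / Suc l < measure \<nu> (K l)"
    by metis
  have Kb[measurable]: "K l \<in> sets borel" for l using K(1) by (simp add: borel_compact)
  let ?W = "\<Union>l. K l"
  have "measure \<nu> (V - ?W) \<le> 1 / Suc l" for l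
  proof -
    have "measure \<nu> (V - ?W) \<le> measure \<nu> (V - K l)"
      using V \<nu>(2) by (intro \<nu>.finite_measure_mono) auto
    also have "\<dots> = measure \<nu> V - measure \<nu> (K l)"
      using V K(2) \<nu>(2) by (intro \<nu>.finite_measure_Diff) auto
    finally show ?thesis using K(3)[of l] by simp
  qed
  then have "measure \<nu> (V - ?W) \<le> 0"
    by (intro LIMSEQ_le_const[OF LIMSEQ_inverse_real_of_nat]) (auto simp: inverse_eq_divide)
  then have "emeasure \<nu> (V - ?W) = 0"
    by (simp add: \<nu>.emeasure_eq_measure order_antisym)
  from ac[OF _ this] have ae: "AE \<gamma> in M. emeasure \<gamma> (V - ?W) = 0" using V by auto
  define C where "C l = (\<Union>i\<le>l. K i)" for l
  have Cc: "compact (C l)" "C l \<subseteq> V" for l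
    unfolding C_def using K by (auto intro!: compact_UN)
  have Cb[measurable]: "C l \<in> sets borel" for l using Cc(1) by (simp add: borel_compact)
  let ?B = "\<lambda>l. {\<gamma>\<in>generalised_configs. emeasure \<gamma> V = \<infinity> \<and> emeasure \<gamma> (C l) < of_nat m}"
  have B: "?B l \<in> sets M" for l
  proof -
    have "{\<gamma>\<in>space config_space. emeasure \<gamma> V = \<infinity> \<and> emeasure \<gamma> (C l) < of_nat m} \<in> sets config_space"
      using V by measurable
    then show ?thesis using M(2) by simp
  qed
  have C_mono: "emeasure \<gamma> (C l) \<le> emeasure \<gamma> (C k)" if "l \<le> k" "\<gamma> \<in> generalised_configs" for l k \<gamma>
    using that unfolding C_def by (intro emeasure_mono UN_mono) auto
  have dec: "decseq ?B"
    unfolding decseq_def using C_mono by (auto intro: le_less_trans)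
  have "emeasure M (\<Inter>l. ?B l) = 0"
  proof -
    have "AE \<gamma> in M. \<gamma> \<notin> (\<Inter>l. ?B l)"
      using ae
    proof eventually_elim
      case (elim \<gamma>)
      show ?case
      proof
        assume a: "\<gamma> \<in> (\<Inter>l. ?B l)"
        then have g: "\<gamma> \<in> generalised_configs" by auto
        have "(SUP l. emeasure \<gamma> (C l)) = emeasure \<gamma> (\<Union>l. C l)"
          using g by (intro SUP_emeasure_incseq incseq_SucI) (auto simp: C_def atMost_Suc)
        moreover have "(\<Union>l. C l) = ?W" by (auto simp: C_def)
        moreover have "(SUP l. emeasure \<gamma> (C l)) \<le> of_nat m"
          using a by (intro SUP_least) (auto intro: less_imp_le)
        ultimately have "emeasure \<gamma> ?W \<le> of_nat m" by simp
        moreover have "emeasure \<gamma> V \<le> emeasure \<gamma> (?W \<union> (V - ?W))"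
          using g V by (intro emeasure_mono) auto
        moreover have "\<dots> \<le> emeasure \<gamma> ?W + emeasure \<gamma> (V - ?W)"
          using g V by (intro emeasure_subadditive) auto
        ultimately have "emeasure \<gamma> V \<le> of_nat m" using elim by simp
        moreover have "emeasure \<gamma> V = \<infinity>" using a by auto
        ultimately show False by (simp add: top_unique)
      qed
    qed
    moreover have "(\<Inter>l. ?B l) \<in> sets M" using B by (intro sets.countable_INT) auto
    ultimately show ?thesis using AE_iff_null_sets by blast
  qed
  moreover have "(\<lambda>l. emeasure M (?B l)) \<longlonglongrightarrow> emeasure M (\<Inter>l. ?B l)"
    using B dec by (intro Lim_emeasure_decseq) (auto simp: M.emeasure_eq_measure)
  ultimately have "\<forall>\<^sub>F l in sequentially. emeasure M (?B l) < e"
    using e by (auto intro: order_tendstoD)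
  then obtain l where "emeasure M (?B l) < e" by (auto simp: eventually_sequentially)
  with Cc show thesis by (intro that)
qed

text \<open>The configurations with an accumulation point form an analytic, possibly non-measurable set.
  The outer measure is continuous along increasing sequences of arbitrary sets, so that the
  accumulation points can be confined to open sets shrinking to a compact set without losing much
  outer measure; inner regularity of the dominating measure then produces a compact set that carries
  infinitely many points with positive probability.\<close>

lemma AE_locally_finite:
  fixes M :: "'a::polish_space measure measure" and \<nu> :: "'a measure"
  assumes M: "finite_measure M" "sets M = sets config_space"
    and \<nu>: "finite_measure \<nu>" "sets \<nu> = sets borel"
    and ac: "\<And>A. A \<in> sets borel \<Longrightarrow> emeasure \<nu> A = 0 \<Longrightarrow> AE \<gamma> in M. emeasure \<gamma> A = 0"
    and cpt: "\<And>K. compact K \<Longrightarrow> AE \<gamma> in M. emeasure \<gamma> K < \<infinity>"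
  shows "AE \<gamma> in M. locally_finite_config \<gamma>"
proof -
  interpret M: finite_measure M by fact
  have spM: "space M = generalised_configs" using sets_eq_imp_space_eq[OF M(2)] by simp
  obtain q :: "nat \<Rightarrow> 'a" where q: "\<And>U. open U \<Longrightarrow> U \<noteq> {} \<Longrightarrow> \<exists>i. q i \<in> U"
    using dense_sequence by blast
  \<comment> \<open>The configurations with an accumulation point in \<open>V\<close>, multiple
    points of infinite mass included. \<open>E UNIV\<close> is the failure of local finiteness, and
    only its outer measure is at hand.\<close>
  define E where "E V = {\<gamma>\<in>generalised_configs. \<exists>z\<in>V. \<forall>U. open U \<and> z \<in> U \<longrightarrow> emeasure \<gamma> U = \<infinity>}"
    for V :: "'a set"
  have E_sub: "E V \<subseteq> space M" for V unfolding E_def spM by auto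
  have "outer_measure_of M (E UNIV) = 0"
  proof (rule ccontr)
    assume "outer_measure_of M (E UNIV) \<noteq> 0"
    then have "0 < outer_measure_of M (E UNIV)" by (simp add: zero_less_iff_neq_zero)
    then obtain c' where c': "0 < c'" "c' < outer_measure_of M (E UNIV)" using dense by blast
    \<comment> \<open>A real level strictly below the outer measure: strictness is what the supremum
      over finite unions of balls needs in order to be exceeded at a finite stage.\<close>
    then obtain c where c: "0 < c" "ennreal c < outer_measure_of M (E UNIV)"
      by (cases c') auto
    let ?P = "\<lambda>V. open V \<and> ennreal c < outer_measure_of M (E V)"
    have "\<exists>V. \<forall>m. ?P (V m) \<and>
        (V (Suc m) \<subseteq> V m \<and> (\<exists>k. V (Suc m) \<subseteq> (\<Union>i\<le>k. ball (q i) ((1/2) ^ m))))"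
    proof (rule dependent_nat_choice)
      show "\<exists>V. ?P V" using c by (intro exI[of _ UNIV]) auto
      fix V :: "'a set" and m :: nat assume V: "?P V"
      let ?V = "\<lambda>k. V \<inter> (\<Union>i\<le>k. ball (q i) ((1/2) ^ m))"
      \<comment> \<open>Each accumulation point in \<open>V\<close> lies in one of the balls of
        radius \<open>(1/2) ^ m\<close> around the dense sequence. By continuity from below,
        finitely many balls keep the outer measure above \<open>c\<close>.\<close>
      have "(\<Union>k. E (?V k)) = E V"
      proof
        show "E V \<subseteq> (\<Union>k. E (?V k))"
        proof
          fix \<gamma> assume "\<gamma> \<in> E V"
          then obtain z where z: "\<gamma> \<in> generalised_configs" "z \<in> V" "\<And>U. open U \<Longrightarrow> z \<in> U \<Longrightarrow> emeasure \<gamma> U = \<infinity>"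
            unfolding E_def by blast
          have "ball z ((1/2) ^ m) \<noteq> {}" by (simp add: not_le)
          then obtain i where "q i \<in> ball z ((1/2) ^ m)" using q[of "ball z ((1/2) ^ m)"] by blast
          then have "z \<in> ?V i" using z(2) by (auto simp: dist_commute intro!: bexI[of _ i])
          then show "\<gamma> \<in> (\<Union>k. E (?V k))" unfolding E_def using z by blast
        qed
      qed (auto simp: E_def)
      moreover have "incseq (\<lambda>k. E (?V k))"
      proof (rule incseq_SucI)
        show "E (?V k) \<subseteq> E (?V (Suc k))" for k
          unfolding E_def by (auto simp: atMost_Suc)
      qed
      ultimately have "ennreal c < (SUP k. outer_measure_of M (E (?V k)))"
        using V SUP_outer_measure_of_incseq[of "\<lambda>k. E (?V k)" M] E_sub by simp
      then obtain k where "ennreal c < outer_measure_of M (E (?V k))" by (auto simp: less_SUP_iff)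
      then show "\<exists>V'. ?P V' \<and> (V' \<subseteq> V \<and> (\<exists>k. V' \<subseteq> (\<Union>i\<le>k. ball (q i) ((1/2) ^ m))))"
        using V by (intro exI[of _ "?V k"]) auto
    qed
    then obtain V where V: "\<And>m. open (V m)" "\<And>m. ennreal c < outer_measure_of M (E (V m))"
      "\<And>m. V (Suc m) \<subseteq> V m" "\<And>m. \<exists>k. V (Suc m) \<subseteq> (\<Union>i\<le>k. ball (q i) ((1/2) ^ m))"
      by metis
    have decV: "decseq V" using V(3) by (rule decseq_SucI)
    \<comment> \<open>Outer measure need not be continuous along decreasing sets, so the limit is
      taken along these measurable events; \<open>?D m\<close> contains \<open>E (V m)\<close>
      because \<open>V m\<close> is a neighbourhood of the accumulation point.\<close>
    let ?D = "\<lambda>m. {\<gamma>\<in>generalised_configs. emeasure \<gamma> (V m) = \<infinity>}"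
    have D: "?D m \<in> sets M" for m
    proof -
      have "{\<gamma>\<in>space config_space. emeasure \<gamma> (V m) = \<infinity>} \<in> sets config_space"
        using V(1) by measurable
      then show ?thesis using M(2) by simp
    qed
    have "ennreal c \<le> emeasure M (\<Inter>m. ?D m)"
    proof (rule LIMSEQ_le_const)
      show "(\<lambda>m. emeasure M (?D m)) \<longlonglongrightarrow> emeasure M (\<Inter>m. ?D m)"
      proof (rule Lim_emeasure_decseq)
        show "decseq ?D"
        proof (rule decseq_SucI)
          fix m
          show "?D (Suc m) \<subseteq> ?D m"
          proof safe
            fix \<gamma> :: "'a measure" assume g: "\<gamma> \<in> generalised_configs" "emeasure \<gamma> (V (Suc m)) = \<infinity>"
            have "emeasure \<gamma> (V (Suc m)) \<le> emeasure \<gamma> (V m)"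
              using V g by (intro emeasure_mono) auto
            with g show "emeasure \<gamma> (V m) = \<infinity>" by (simp add: top_unique)
          qed
        qed
      qed (use D in \<open>auto simp: M.emeasure_eq_measure\<close>)
      have "ennreal c \<le> emeasure M (?D m)" for m
      proof -
        have "E (V m) \<subseteq> ?D m" unfolding E_def using V(1) by auto
        then have "outer_measure_of M (E (V m)) \<le> outer_measure_of M (?D m)"
          by (rule outer_measure_of_mono)
        with V(2)[of m] D show ?thesis by simp
      qed
      then show "\<exists>N. \<forall>n\<ge>N. ennreal c \<le> emeasure M (?D n)" by blast
    qed
    moreover have "emeasure M (\<Inter>m. ?D m) \<le> ennreal (c / 2)"
    proof -
      let ?B = "\<lambda>m C. {\<gamma>\<in>generalised_configs. emeasure \<gamma> (V m) = \<infinity> \<and> emeasure \<gamma> C < of_nat m}"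
      \<comment> \<open>The allowances add up to \<open>c / 2\<close>, which is below the lower
        bound \<open>c\<close>. Asking for \<open>m\<close> points in the \<open>m\<close>-th
        compact set makes the counts unbounded.\<close>
      have "\<exists>C. compact C \<and> C \<subseteq> V m \<and> emeasure M (?B m C) < ennreal (c / 2 * (1/2) ^ Suc m)" for m
      proof -
        have *: "V m \<in> sets borel" "0 < ennreal (c / 2 * (1/2) ^ Suc m)" using V(1) c by auto
        show ?thesis
        proof (rule inner_compact_configs[OF M \<nu>])
          show "emeasure \<nu> A = 0 \<Longrightarrow> AE \<gamma> in M. emeasure \<gamma> A = 0" if "A \<in> sets borel" for A
            using ac that by blast
        qed (use * in blast)+
      qed
      then obtain C where C: "\<And>m. compact (C m)" "\<And>m. C m \<subseteq> V m"
        "\<And>m. emeasure M (?B m (C m)) < ennreal (c / 2 * (1/2) ^ Suc m)"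
        using choice[of "\<lambda>m C. compact C \<and> C \<subseteq> V m \<and> emeasure M (?B m C) < ennreal (c / 2 * (1/2) ^ Suc m)"]
        by blast
      let ?K = "closure (\<Union>m. C m)"
      have "compact ?K"
      proof (rule compact_closure_shrinking[OF C(1,2) decV])
        fix e :: real assume "0 < e"
        then obtain m where m: "(1/2) ^ m < e" using real_arch_pow_inv[of e "1/2"] by auto
        obtain k where "V (Suc m) \<subseteq> (\<Union>i\<le>k. ball (q i) ((1/2) ^ m))" using V(4) by blast
        also have "\<dots> \<subseteq> (\<Union>x\<in>q ` {..k}. ball x e)"
          using m subset_ball[of "(1/2) ^ m" e] by fastforce
        finally show "\<exists>m F. finite F \<and> V m \<subseteq> (\<Union>x\<in>F. ball x e)" by blast
      qed
      have B: "?B m (C m) \<in> sets M" for m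
      proof -
        have "C m \<in> sets borel" "V m \<in> sets borel" using C(1) V(1) by (auto simp: borel_compact)
        then have "{\<gamma>\<in>space config_space. emeasure \<gamma> (V m) = \<infinity> \<and> emeasure \<gamma> (C m) < of_nat m} \<in> sets config_space"
          by measurable
        then show ?thesis using M(2) by simp
      qed
      \<comment> \<open>If no \<open>?B m (C m)\<close> occurs, then \<open>?K\<close> contains at
        least \<open>m\<close> points for every \<open>m\<close>, which \<open>cpt\<close> excludes
        almost surely.\<close>
      have "emeasure M (\<Inter>m. ?D m) \<le> emeasure M (\<Union>m. ?B m (C m))"
      proof (rule emeasure_mono_AE)
        show "AE \<gamma> in M. \<gamma> \<in> (\<Inter>m. ?D m) \<longrightarrow> \<gamma> \<in> (\<Union>m. ?B m (C m))"
          using cpt[OF \<open>compact ?K\<close>]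
        proof eventually_elim
          case (elim \<gamma>)
          show ?case
          proof
            assume d: "\<gamma> \<in> (\<Inter>m. ?D m)"
            obtain m where m: "emeasure \<gamma> ?K < of_nat m"
              using elim by (metis ennreal_Ex_less_of_nat infinity_ennreal_def)
            have "emeasure \<gamma> (C m) \<le> emeasure \<gamma> ?K"
              using d closure_subset[of "\<Union>m. C m"] by (intro emeasure_mono) auto
            with m d show "\<gamma> \<in> (\<Union>m. ?B m (C m))" by (auto intro: le_less_trans)
          qed
        qed
      qed (use B in auto)
      also have "\<dots> \<le> (\<Sum>m. emeasure M (?B m (C m)))"
        using B by (intro emeasure_subadditive_countably) auto
      also have "\<dots> \<le> (\<Sum>m. ennreal (c / 2 * (1/2) ^ Suc m))"
        using C(3) by (intro suminf_le) (auto intro: less_imp_le)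
      also have "\<dots> = ennreal (c / 2)"
        using c power_half_series sums_mult[OF power_half_series, of "c / 2"]
        by (intro suminf_ennreal_eq) auto
      finally show ?thesis .
    qed
    ultimately have "ennreal c \<le> ennreal (c / 2)" by simp
    with c show False by simp
  qed
  \<comment> \<open>Outer measure zero supplies a measurable null cover, which is all that an almost
    sure statement asks for.\<close>
  then obtain N where N: "N \<in> sets M" "E UNIV \<subseteq> N" "emeasure M N = 0"
    using outer_measure_of_attain[OF E_sub, of UNIV] by auto
  show ?thesis
  proof (rule AE_I)
    show "{\<gamma> \<in> space M. \<not> locally_finite_config \<gamma>} \<subseteq> N"
    proof safe
      fix \<gamma> assume g: "\<gamma> \<in> space M" "\<not> locally_finite_config \<gamma>"
      then obtain z where "\<forall>U. open U \<and> z \<in> U \<longrightarrow> \<not> emeasure \<gamma> U < \<infinity>"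
        unfolding spM by (subst (asm) locally_finite_iff) blast+
      then have "\<gamma> \<in> E UNIV"
        using g(1) unfolding spM E_def by (auto simp: less_top[symmetric] intro!: exI[of _ z])
      then show "\<gamma> \<in> N" using N by blast
    qed
  qed (use N in auto)
qed

section \<open>Simple configurations\<close>

lemma emeasure_simple:
  fixes \<gamma> :: "'a::t1_space measure"
  assumes "\<gamma> \<in> generalised_configs" "simple_config \<gamma>" "A \<in> sets borel"
  shows "emeasure \<gamma> A = emeasure (count_space UNIV) (points \<gamma> \<inter> A)"
proof -
  have "emeasure \<gamma> A = emeasure (count_space (points \<gamma>)) {x\<in>points \<gamma>. x \<in> A}"
    using emeasure_superpose_return[OF countable_points[OF assms(1)] assms(3), of "\<lambda>x. x"]
      simple_eq_superpose_points[OF assms(1,2)] by simp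
  also have "{x\<in>points \<gamma>. x \<in> A} = points \<gamma> \<inter> A" by auto
  finally show ?thesis by (simp add: emeasure_count_space)
qed

text \<open>In a ball of finite count, a simple configuration has a positive minimal distance, so
  all small enough balls meet it in at most one point there. This condition involves countably many
  counts. Conversely, local finiteness puts every point into a ball of finite count, where the
  condition bounds its mass by 1.\<close>

lemma simple_config_hull:
  obtains S :: "'a::polish_space measure set" where "S \<in> sets config_space"
    "\<And>\<gamma>. \<gamma> \<in> generalised_configs \<Longrightarrow> simple_config \<gamma> \<Longrightarrow> \<gamma> \<in> S"
    "\<And>\<gamma>. \<gamma> \<in> S \<Longrightarrow> locally_finite_config \<gamma> \<Longrightarrow> simple_config \<gamma>"
proof -
  obtain q :: "nat \<Rightarrow> 'a" where q: "\<And>U. open U \<Longrightarrow> U \<noteq> {} \<Longrightarrow> \<exists>i. q i \<in> U"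
    using dense_sequence by blast
  define b where "b i m = ball (q i) ((1/2) ^ m)" for i m :: nat
  have qb: "\<exists>i. x \<in> b i m" for x m
  proof -
    have "ball x ((1/2) ^ m) \<noteq> {}" by (simp add: not_le)
    then show ?thesis using q[of "ball x ((1/2) ^ m)"] by (auto simp: b_def dist_commute)
  qed
  have [measurable]: "b i m \<in> sets borel" for i m by (simp add: b_def)
  let ?S = "{\<gamma>\<in>space config_space. \<forall>i n. emeasure \<gamma> (b i n) = \<infinity> \<or>
      (\<exists>m. \<forall>j. emeasure \<gamma> (b i n \<inter> b j m) \<le> 1)}"
  show thesis
  proof (rule that)
    show "?S \<in> sets config_space" by measurable
  next
    fix \<gamma> :: "'a measure" assume g: "\<gamma> \<in> generalised_configs" "simple_config \<gamma>"
    have "\<exists>m. \<forall>j. emeasure \<gamma> (b i n \<inter> b j m) \<le> 1" if fin: "emeasure \<gamma> (b i n) \<noteq> \<infinity>" for i n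
    proof -
      let ?F = "points \<gamma> \<inter> b i n"
      have F: "finite ?F"
        using fin by (subst (asm) emeasure_simple[OF g]) (auto simp: emeasure_count_space split: if_splits)
      \<comment> \<open>The entry 1 keeps the minimum defined when \<open>?F\<close> has fewer than
        two points. Two points in a ball of radius below \<open>?d / 2\<close> would be closer than
        \<open>?d\<close>.\<close>
      let ?d = "Min (insert 1 ((\<lambda>(x, y). dist x y) ` (?F \<times> ?F - Id)))"
      have "0 < ?d" using F by (subst Min_gr_iff) auto
      then obtain m where m: "(1/2) ^ m < ?d / 2" using real_arch_pow_inv[of "?d / 2" "1/2"] by auto
      have "emeasure \<gamma> (b i n \<inter> b j m) \<le> 1" for j
      proof -
        have "x = y" if "x \<in> ?F \<inter> b j m" "y \<in> ?F \<inter> b j m" for x y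
        proof (rule ccontr)
          assume "x \<noteq> y"
          with that F have "?d \<le> dist x y" by (intro Min_le) (auto intro!: image_eqI[of _ _ "(x, y)"])
          moreover have "dist x y < (1/2) ^ m + (1/2) ^ m"
            using that by (intro dist_triangle_less_add[of _ "q j"]) (auto simp: b_def dist_commute)
          ultimately show False using m by simp
        qed
        then have "card (points \<gamma> \<inter> (b i n \<inter> b j m)) \<le> 1"
          by (metis One_nat_def card_le_Suc0_iff_eq Int_assoc F finite_Int)
        moreover have "finite (points \<gamma> \<inter> (b i n \<inter> b j m))" using F by (metis Int_assoc finite_Int)
        ultimately show ?thesis
          by (subst emeasure_simple[OF g]) (auto simp: emeasure_count_space of_nat_le_1_iff)
      qed
      then show ?thesis by blast
    qed
    then show "\<gamma> \<in> ?S" using g by auto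
  next
    fix \<gamma> :: "'a measure" assume S: "\<gamma> \<in> ?S" and lf: "locally_finite_config \<gamma>"
    then have g: "\<gamma> \<in> generalised_configs" by simp
    show "simple_config \<gamma>" unfolding simple_config_def
    proof
      fix x
      obtain U where U: "open U" "x \<in> U" "emeasure \<gamma> U < \<infinity>"
        using lf g by (auto simp: locally_finite_iff)
      then obtain e where e: "0 < e" "ball x e \<subseteq> U" by (auto simp: open_contains_ball)
      then obtain n where n: "(1/2) ^ n < e / 2" using real_arch_pow_inv[of "e / 2" "1/2"] by auto
      obtain i where i: "x \<in> b i n" using qb by blast
      have "b i n \<subseteq> ball x e"
      proof
        fix y assume "y \<in> b i n"
        then have "dist x y < (1/2) ^ n + (1/2) ^ n"
          using i by (intro dist_triangle_less_add[of _ "q i"]) (auto simp: b_def dist_commute)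
        then show "y \<in> ball x e" using n by simp
      qed
      then have "emeasure \<gamma> (b i n) \<le> emeasure \<gamma> U"
        using e U g by (intro emeasure_mono) auto
      then have "emeasure \<gamma> (b i n) \<noteq> \<infinity>" using U(3) by auto
      then obtain m where m: "\<And>j. emeasure \<gamma> (b i n \<inter> b j m) \<le> 1" using S by blast
      obtain j where j: "x \<in> b j m" using qb by blast
      have "emeasure \<gamma> {x} \<le> emeasure \<gamma> (b i n \<inter> b j m)"
        using i j g by (intro emeasure_mono) auto
      then show "emeasure \<gamma> {x} \<le> 1" using m order_trans by blast
    qed
  qed
qed

section \<open>A finite measure equivalent to a locally finite configuration\<close>

lemma basis_sequence:
  obtains U :: "nat \<Rightarrow> 'a::second_countable_topology set" where "\<And>n. open (U n)"
    "\<And>V x. open V \<Longrightarrow> x \<in> V \<Longrightarrow> \<exists>n. x \<in> U n \<and> U n \<subseteq> V"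
proof -
  obtain B :: "'a set set" where B: "countable B" "topological_basis B"
    using ex_countable_basis by blast
  have ne: "B \<noteq> {}"
    using topological_basisE[OF B(2) open_UNIV, of undefined] by blast
  show thesis
  proof (rule that)
    show "open (from_nat_into B n)" for n
      using from_nat_into[OF ne] B(2) by (auto simp: topological_basis_open)
    fix V :: "'a set" and x assume "open V" "x \<in> V"
    then obtain W where W: "W \<in> B" "x \<in> W" "W \<subseteq> V" using topological_basisE[OF B(2)] by metis
    then show "\<exists>n. x \<in> from_nat_into B n \<and> from_nat_into B n \<subseteq> V"
      using from_nat_into_surj[OF B(1) W(1)] by auto
  qed
qed

text \<open>For a locally finite configuration, the members of a countable base with finite mass
  cover the space. Summing the normalised restrictions to base sets with weights
  \<open>(1/2) ^ Suc n\<close> gives a measure of mass at most 1 that vanishes only on null sets of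
  the configuration. The formula involves only counts, so it is measurable in the
  configuration.\<close>

lemma dominating_kernel:
  obtains T :: "'a::polish_space measure \<Rightarrow> 'a measure"
  where "T \<in> config_space \<rightarrow>\<^sub>M subprob_algebra borel"
    "\<And>\<xi> A. \<xi> \<in> generalised_configs \<Longrightarrow> locally_finite_config \<xi> \<Longrightarrow> A \<in> sets borel \<Longrightarrow>
      emeasure (T \<xi>) A = 0 \<Longrightarrow> emeasure \<xi> A = 0"
proof -
  obtain U :: "nat \<Rightarrow> 'a set" where U: "\<And>n. open (U n)"
    "\<And>V x. open V \<Longrightarrow> x \<in> V \<Longrightarrow> \<exists>n. x \<in> U n \<and> U n \<subseteq> V"
    using basis_sequence by blast
  have [measurable]: "U n \<in> sets borel" for n using U(1) by simp
  \<comment> \<open>Adding 1 avoids division by zero, and a base set of infinite mass contributes 0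
    because its denominator is \<infinity>.\<close>
  define h where "h \<xi> x = (\<Sum>n. ennreal ((1/2) ^ Suc n) * (indicator (U n) x / (1 + emeasure \<xi> (U n))))"
    for \<xi> :: "'a measure" and x
  have hm: "h \<xi> \<in> borel_measurable borel" for \<xi>
    unfolding h_def by measurable
  have hT: "emeasure (density \<xi> (h \<xi>)) A
      = (\<Sum>n. ennreal ((1/2) ^ Suc n) * (emeasure \<xi> (A \<inter> U n) / (1 + emeasure \<xi> (U n))))"
    if g: "\<xi> \<in> generalised_configs" and A[measurable]: "A \<in> sets borel" for \<xi> A
  proof -
    note [measurable_cong] = sets_generalised[OF g]
    have [measurable]: "h \<xi> \<in> borel_measurable \<xi>" using hm by measurable
    have "emeasure (density \<xi> (h \<xi>)) A = (\<integral>\<^sup>+x. h \<xi> x * indicator A x \<partial>\<xi>)"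
      by (rule emeasure_density) measurable
    also have "\<dots> = (\<integral>\<^sup>+x. (\<Sum>n. (ennreal ((1/2) ^ Suc n) / (1 + emeasure \<xi> (U n))) * indicator (A \<inter> U n) x) \<partial>\<xi>)"
      unfolding h_def
      by (intro nn_integral_cong)
        (auto simp: divide_ennreal_def indicator_inter_arith ac_simps split: split_indicator)
    also have "\<dots> = (\<Sum>n. (\<integral>\<^sup>+x. (ennreal ((1/2) ^ Suc n) / (1 + emeasure \<xi> (U n))) * indicator (A \<inter> U n) x \<partial>\<xi>))"
      by (rule nn_integral_suminf) measurable
    also have "\<dots> = (\<Sum>n. (ennreal ((1/2) ^ Suc n) / (1 + emeasure \<xi> (U n))) * emeasure \<xi> (A \<inter> U n))"
      by (intro suminf_cong nn_integral_cmult_indicator) measurable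
    finally show ?thesis by (simp add: divide_ennreal_def ac_simps)
  qed
  have le1: "emeasure \<xi> (A \<inter> U n) / (1 + emeasure \<xi> (U n)) \<le> 1"
    if "\<xi> \<in> generalised_configs" for \<xi> A n
  proof (rule divide_le_posI_ennreal)
    have "emeasure \<xi> (A \<inter> U n) \<le> emeasure \<xi> (U n)"
      using that by (intro emeasure_mono) auto
    also have "\<dots> \<le> 1 + emeasure \<xi> (U n)" by simp
    finally show "emeasure \<xi> (A \<inter> U n) \<le> (1 + emeasure \<xi> (U n)) * 1" by simp
  qed (simp add: add_pos_nonneg)
  show thesis
  proof (rule that[of "\<lambda>\<xi>. density \<xi> (h \<xi>)"])
    show "(\<lambda>\<xi>. density \<xi> (h \<xi>)) \<in> config_space \<rightarrow>\<^sub>M subprob_algebra borel"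
    proof (rule measurable_subprob_algebra)
      fix \<xi> :: "'a measure" assume "\<xi> \<in> space config_space"
      then have g: "\<xi> \<in> generalised_configs" by simp
      then show "sets (density \<xi> (h \<xi>)) = sets borel" by simp
      show "subprob_space (density \<xi> (h \<xi>))"
      proof (rule subprob_spaceI)
        have borel_UNIV: "UNIV \<in> sets borel" by simp
        have "emeasure (density \<xi> (h \<xi>)) UNIV \<le> (\<Sum>n. ennreal ((1/2) ^ Suc n))"
          unfolding hT[OF g borel_UNIV]
          using mult_left_mono[OF le1[OF g, of UNIV]] by (intro suminf_le) auto
        also have "\<dots> = 1"
          using power_half_series by (intro suminf_ennreal_eq[of _ 1, simplified]) auto
        finally show "emeasure (density \<xi> (h \<xi>)) (space (density \<xi> (h \<xi>))) \<le> 1"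
          using g by simp
      qed (use g in simp)
    next
      fix A :: "'a set" assume A[measurable]: "A \<in> sets borel"
      have "(\<lambda>\<xi>. \<Sum>n. ennreal ((1/2) ^ Suc n) * (emeasure \<xi> (A \<inter> U n) / (1 + emeasure \<xi> (U n))))
          \<in> borel_measurable config_space"
        by measurable
      moreover have "emeasure (density \<xi> (h \<xi>)) A
          = (\<Sum>n. ennreal ((1/2) ^ Suc n) * (emeasure \<xi> (A \<inter> U n) / (1 + emeasure \<xi> (U n))))"
        if "\<xi> \<in> space config_space" for \<xi>
        using that A by (intro hT) auto
      ultimately show "(\<lambda>\<xi>. emeasure (density \<xi> (h \<xi>)) A) \<in> borel_measurable config_space"
        by (subst measurable_cong) assumption+
    qed
  next
    fix \<xi> :: "'a measure" and A :: "'a set"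
    assume g: "\<xi> \<in> generalised_configs" and lf: "locally_finite_config \<xi>" and A: "A \<in> sets borel"
      and 0: "emeasure (density \<xi> (h \<xi>)) A = 0"
    let ?J = "{n. emeasure \<xi> (U n) < \<infinity>}"
    have "emeasure \<xi> (A \<inter> U n) = 0" if "n \<in> ?J" for n
    proof -
      from 0 have "ennreal ((1/2) ^ Suc n) * (emeasure \<xi> (A \<inter> U n) / (1 + emeasure \<xi> (U n))) = 0"
        unfolding hT[OF g A] by (subst (asm) suminf_eq_zero_iff) auto
      with that show ?thesis by (auto simp: less_top[symmetric])
    qed
    then have "(\<Union>n\<in>?J. A \<inter> U n) \<in> null_sets \<xi>"
      using A g by (intro null_sets_UN') auto
    moreover have "A \<subseteq> (\<Union>n\<in>?J. A \<inter> U n)"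
    proof
      fix x assume "x \<in> A"
      obtain V where V: "open V" "x \<in> V" "emeasure \<xi> V < \<infinity>" using lf g by (auto simp: locally_finite_iff)
      then obtain n where n: "x \<in> U n" "U n \<subseteq> V" using U(2) by blast
      then have "emeasure \<xi> (U n) \<le> emeasure \<xi> V" using V(1) g by (intro emeasure_mono) auto
      then have "n \<in> ?J" using V(3) by (auto intro: le_less_trans)
      with n(1) \<open>x \<in> A\<close> show "x \<in> (\<Union>n\<in>?J. A \<inter> U n)" by blast
    qed
    ultimately show "emeasure \<xi> A = 0"
      using A g by (metis null_setsD1 null_sets_subset sets_generalised)
  qed
qed

section \<open>The cluster process\<close>

text \<open>Both measures agree on cylinders over finitely many coordinates. This connects the
  disjointness condition, stated for products of the \<open>\<eta> x\<close>, with the product of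
  the cluster laws.\<close>

lemma distr_PiM_map:
  assumes P: "\<And>i. prob_space (P i)" and f: "\<And>i. f \<in> P i \<rightarrow>\<^sub>M N"
  shows "distr (PiM I P) (PiM I (\<lambda>_. N)) (\<lambda>y. \<lambda>i\<in>I. f (y i)) = PiM I (\<lambda>i. distr (P i) N f)"
proof -
  interpret D: product_prob_space "\<lambda>i. distr (P i) N f" I
    by (intro product_prob_spaceI prob_space.prob_space_distr P f)
  interpret P: product_prob_space P I
    by (intro product_prob_spaceI P)
  have m: "(\<lambda>y. \<lambda>i\<in>I. f (y i)) \<in> PiM I P \<rightarrow>\<^sub>M PiM I (\<lambda>_. N)"
  proof (rule measurable_restrict)
    show "(\<lambda>y. f (y i)) \<in> PiM I P \<rightarrow>\<^sub>M N" if "i \<in> I" for i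
      by (rule measurable_compose[OF measurable_component_singleton[OF that] f])
  qed
  show ?thesis
  proof (rule D.PiM_eq)
    show "sets (distr (PiM I P) (PiM I (\<lambda>_. N)) (\<lambda>y. \<lambda>i\<in>I. f (y i))) = sets (PiM I (\<lambda>i. distr (P i) N f))"
      unfolding sets_distr by (rule sets_PiM_cong) auto
    fix J F assume J: "finite J" "J \<subseteq> I" and F: "\<And>j. j \<in> J \<Longrightarrow> F j \<in> sets (distr (P j) N f)"
    let ?G = "\<lambda>j. f -` F j \<inter> space (P j)"
    have G: "?G j \<in> sets (P j)" if "j \<in> J" for j
      using F[OF that] f by (auto intro: measurable_sets)
    have emb: "prod_emb I (\<lambda>i. distr (P i) N f) J (Pi\<^sub>E J F) \<in> sets (PiM I (\<lambda>_. N))"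
    proof -
      have "prod_emb I (\<lambda>i. distr (P i) N f) J (Pi\<^sub>E J F) \<in> sets (PiM I (\<lambda>i. distr (P i) N f))"
        using J F by (intro sets_PiM_I) auto
      also have "sets (PiM I (\<lambda>i. distr (P i) N f)) = sets (PiM I (\<lambda>_. N))"
        by (rule sets_PiM_cong) auto
      finally show ?thesis .
    qed
    have "emeasure (distr (PiM I P) (PiM I (\<lambda>_. N)) (\<lambda>y. \<lambda>i\<in>I. f (y i)))
        (prod_emb I (\<lambda>i. distr (P i) N f) J (Pi\<^sub>E J F))
      = emeasure (PiM I P) ((\<lambda>y. \<lambda>i\<in>I. f (y i)) -` prod_emb I (\<lambda>i. distr (P i) N f) J (Pi\<^sub>E J F) \<inter> space (PiM I P))"
      by (rule emeasure_distr[OF m emb])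
    also have "(\<lambda>y. \<lambda>i\<in>I. f (y i)) -` prod_emb I (\<lambda>i. distr (P i) N f) J (Pi\<^sub>E J F) \<inter> space (PiM I P)
      = prod_emb I P J (Pi\<^sub>E J ?G)"
    proof (rule set_eqI)
      fix y
      have r: "restrict (\<lambda>i\<in>I. f (y i)) J = (\<lambda>j\<in>J. f (y j))"
        using J(2) by (auto simp: restrict_def fun_eq_iff)
      show "y \<in> (\<lambda>y. \<lambda>i\<in>I. f (y i)) -` prod_emb I (\<lambda>i. distr (P i) N f) J (Pi\<^sub>E J F) \<inter> space (PiM I P)
          \<longleftrightarrow> y \<in> prod_emb I P J (Pi\<^sub>E J ?G)"
      proof (cases "y \<in> space (PiM I P)")
        case True
        then have "y i \<in> space (P i)" if "i \<in> I" for i using that by (auto simp: space_PiM)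
        moreover from this have "f (y i) \<in> space N" if "i \<in> I" for i
          using measurable_space[OF f] that by blast
        ultimately show ?thesis
          using True J(2) by (simp add: prod_emb_def r space_PiM restrict_PiE_iff PiE_iff subset_iff Int_absorb1[OF J(2)])
      qed (simp add: prod_emb_def space_PiM)
    qed
    also have "emeasure (PiM I P) \<dots> = (\<Prod>j\<in>J. emeasure (P j) (?G j))"
      using J G by (intro P.emeasure_PiM_emb) auto
    also have "\<dots> = (\<Prod>j\<in>J. emeasure (distr (P j) N f) (F j))"
      using F by (intro prod.cong refl emeasure_distr[symmetric] f) auto
    finally show "emeasure (distr (PiM I P) (PiM I (\<lambda>_. N)) (\<lambda>y. \<lambda>i\<in>I. f (y i)))
        (prod_emb I (\<lambda>i. distr (P i) N f) J (Pi\<^sub>E J F)) = (\<Prod>j\<in>J. emeasure (distr (P j) N f) (F j))" .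
  qed
qed

section \<open>Hitting events and simplicity of superpositions\<close>

lemma emeasure_seq_config_eq_0_iff:
  "B \<in> sets borel \<Longrightarrow> emeasure (seq_config y) B = 0 \<longleftrightarrow> (\<forall>i\<in>indices y. snd y i \<notin> B)"
  by (auto simp: emeasure_seq_config emeasure_count_space_eq_0)

lemma pred_count: "B \<in> sets borel \<Longrightarrow> S \<in> sets borel \<Longrightarrow>
    {\<xi>\<in>generalised_configs. emeasure \<xi> B \<in> S} \<in> sets config_space"
  using measurable_sets[OF measurable_config_count[of B], of S]
  by (simp add: vimage_def Int_def conj_commute)

lemma hitting_sets: "B \<in> sets borel \<Longrightarrow> hitting B \<in> sets seq_space"
proof -
  assume B: "B \<in> sets borel"
  have "hitting B = (\<Union>i. {y \<in> space seq_space. i \<in> indices y \<and> snd y i \<in> B})"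
    by (auto simp: hitting_def)
  then show ?thesis using sets_seq_space_coord[OF B] by auto
qed

text \<open>A point lies in at most one of the two clusters, and there at most once. The case
  \<open>x1 = x2\<close> is deliberate: the pair collapses to one cluster and records that it is
  simple.\<close>

lemma superpose_pair_simple:
  fixes y :: "'a::t1_space \<Rightarrow> enat \<times> (nat \<Rightarrow> 'a)"
  assumes y: "y \<in> disjoint_distinct_families \<gamma>" and x: "x1 \<in> points \<gamma>" "x2 \<in> points \<gamma>"
  shows "simple_config (superpose {x1, x2} (\<lambda>x. seq_config (y x)))"
  unfolding simple_config_def
proof
  fix p :: 'a
  have inj: "inj_on (snd (y x)) (indices (y x))" if "x \<in> points \<gamma>" for x
    using y that by (auto simp: disjoint_distinct_families_def distinct_seqs_def PiE_iff)
  have le: "emeasure (seq_config (y x)) {p} \<le> 1" if "x \<in> points \<gamma>" for x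
  proof -
    have "card {i \<in> indices (y x). snd (y x) i = p} \<le> 1 \<and> finite {i \<in> indices (y x). snd (y x) i = p}"
    proof (cases "\<exists>i\<in>indices (y x). snd (y x) i = p")
      case True
      then obtain i where "i \<in> indices (y x)" "snd (y x) i = p" by blast
      then have "{i \<in> indices (y x). snd (y x) i = p} = {i}"
        using inj_onD[OF inj[OF that]] by blast
      then show ?thesis by simp
    next
      case False
      then have "{i \<in> indices (y x). snd (y x) i = p} = {}" by blast
      then show ?thesis by (simp only:) simp
    qed
    then show ?thesis by (subst emeasure_seq_config) (auto simp: emeasure_count_space of_nat_le_1_iff)
  qed
  have z: "emeasure (seq_config (y x)) {p} = 0" if "p \<notin> coords (y x)" for x
    using that by (subst emeasure_seq_config_eq_0_iff) (auto simp: coords_def)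
  have "emeasure (superpose {x1, x2} (\<lambda>x. seq_config (y x))) {p} = (\<Sum>x\<in>{x1, x2}. emeasure (seq_config (y x)) {p})"
    by (subst emeasure_superpose) (auto simp: nn_integral_count_space_finite)
  also have "\<dots> \<le> 1"
  proof (cases "x1 = x2")
    case False
    then have "p \<notin> coords (y x1) \<or> p \<notin> coords (y x2)"
      using y x by (auto simp: disjoint_distinct_families_def)
    then show ?thesis using False le x z by auto
  qed (use le x in auto)
  finally show "emeasure (superpose {x1, x2} (\<lambda>x. seq_config (y x))) {p} \<le> 1" .
qed

text \<open>Counts are integers: two members charging the same point would give it mass at least 2
  in their pair. Hence at most one member contributes, and the degenerate pair bounds its mass by
  1.\<close>

lemma superpose_simple:
  fixes g :: "'i \<Rightarrow> 'b::t1_space measure"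
  assumes I: "countable I" and g: "\<And>x. x \<in> I \<Longrightarrow> g x \<in> generalised_configs"
    and s: "\<And>x1 x2. x1 \<in> I \<Longrightarrow> x2 \<in> I \<Longrightarrow> simple_config (superpose {x1, x2} g)"
  shows "simple_config (superpose I g)"
  unfolding simple_config_def
proof
  fix p :: 'b
  have pair: "(\<Sum>x\<in>{x1, x2}. emeasure (g x) {p}) \<le> 1" if "x1 \<in> I" "x2 \<in> I" for x1 x2
  proof -
    have "emeasure (superpose {x1, x2} g) {p} = (\<Sum>x\<in>{x1, x2}. emeasure (g x) {p})"
      using that g by (subst emeasure_superpose) (auto simp: nn_integral_count_space_finite)
    then show ?thesis using s[OF that] unfolding simple_config_def by metis
  qed
  have e: "emeasure (superpose I g) {p} = (\<integral>\<^sup>+x. emeasure (g x) {p} \<partial>count_space I)"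
    using g by (intro emeasure_superpose I) auto
  show "emeasure (superpose I g) {p} \<le> 1"
  proof (cases "\<exists>x1\<in>I. emeasure (g x1) {p} \<noteq> 0")
    case False
    then have "(\<integral>\<^sup>+x. emeasure (g x) {p} \<partial>count_space I) = (\<integral>\<^sup>+x. 0 \<partial>count_space I)"
      by (intro nn_integral_cong) auto
    then show ?thesis by (simp add: e)
  next
    case True
    then obtain x1 where x1: "x1 \<in> I" "emeasure (g x1) {p} \<noteq> 0" by blast
    have ge: "1 \<le> emeasure (g x) {p}" if "x \<in> I" "emeasure (g x) {p} \<noteq> 0" for x
      by (cases rule: generalised_count[OF g[OF that(1)], of "{p}"]) (use that(2) in \<open>auto simp: Suc_le_eq\<close>)
    have "emeasure (g x) {p} = 0" if "x \<in> I" "x \<noteq> x1" for x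
    proof (rule ccontr)
      assume "emeasure (g x) {p} \<noteq> 0"
      then have "1 + 1 \<le> emeasure (g x1) {p} + emeasure (g x) {p}"
        using ge[OF that(1)] ge[OF x1] by (intro add_mono)
      also have "\<dots> \<le> 1" using pair[OF x1(1) that(1)] that(2) by simp
      finally show False by simp
    qed
    then have "(\<integral>\<^sup>+x. emeasure (g x) {p} \<partial>count_space I) = (\<integral>\<^sup>+x. emeasure (g x1) {p} * indicator {x1} x \<partial>count_space I)"
      by (intro nn_integral_cong) (auto split: split_indicator)
    also have "\<dots> = emeasure (g x1) {p}"
      using x1(1) by (subst nn_integral_cmult_indicator) (auto simp: emeasure_count_space)
    finally show ?thesis using pair[OF x1(1) x1(1)] by (simp add: e)
  qed
qed

section \<open>The cluster measure as a mixture over the centres\<close>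

locale cluster_process =
  fixes \<mu> :: "'a::polish_space measure measure"
    and \<eta> :: "'a \<Rightarrow> (enat \<times> (nat \<Rightarrow> 'a)) measure"
  assumes mu_prob: "prob_space \<mu>"
    and mu_sets: "sets \<mu> = sets config_space"
    and mu_proper: "emeasure (completion \<mu>) proper_configs = 1"
    and eta_prob: "\<And>x. prob_space (\<eta> x)"
    and eta_sets: "\<And>x. sets (\<eta> x) = sets seq_space"
    and eta_meas: "\<And>B. B \<in> sets seq_space \<Longrightarrow> (\<lambda>x. emeasure (\<eta> x) B) \<in> borel_measurable borel"
    and eta_proper: "\<And>x. AE y in \<eta> x.
          locally_finite_config (seq_config y) \<and> simple_config (seq_config y)"
begin

lemma AE_proper: "AE \<gamma> in \<mu>. \<gamma> \<in> proper_configs"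
proof -
  interpret mu: prob_space \<mu> by (rule mu_prob)
  interpret c: prob_space "completion \<mu>" by (rule mu.prob_space_completion)
  have "measure (completion \<mu>) proper_configs = 1" using mu_proper by (simp add: measure_def)
  from c.AE_prob_1[OF this] show ?thesis by (simp add: AE_completion_iff)
qed

text \<open>\<open>proper_configs\<close> is given full mass only in the completion; a measurable
  subset of full measure is needed to define a kernel by cases.\<close>

lemma proper_core:
  obtains P where "P \<in> sets \<mu>" "P \<subseteq> proper_configs" "AE \<gamma> in \<mu>. \<gamma> \<in> P"
proof -
  from AE_proper obtain N where N: "{\<gamma> \<in> space \<mu>. \<gamma> \<notin> proper_configs} \<subseteq> N" "emeasure \<mu> N = 0" "N \<in> sets \<mu>"
    by (rule AE_E)
  show thesis
  proof (rule that)
    show "AE \<gamma> in \<mu>. \<gamma> \<in> space \<mu> - N"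
      using N AE_not_in[of N \<mu>] AE_space[of \<mu>] by (auto simp: null_sets_def)
  qed (use N in auto)
qed

definition cluster_law :: "'a \<Rightarrow> 'a measure measure" where
  "cluster_law x = distr (\<eta> x) config_space seq_config"

lemma seq_config_eta [measurable]: "seq_config \<in> \<eta> x \<rightarrow>\<^sub>M config_space"
  using measurable_seq_config by (simp cong: measurable_cong_sets add: eta_sets)

lemma prob_cluster_law: "prob_space (cluster_law x)"
  unfolding cluster_law_def by (intro prob_space.prob_space_distr eta_prob seq_config_eta)

lemma sets_cluster_law [simp]: "sets (cluster_law x) = sets config_space"
  by (simp add: cluster_law_def)

lemma clusters_eq: "clusters \<eta> \<gamma> = PiM (points \<gamma>) cluster_law"
  by (simp add: clusters_def cluster_law_def[abs_def])

lemma prob_clusters: "prob_space (clusters \<eta> \<gamma>)"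
  unfolding clusters_eq by (intro prob_space_PiM prob_cluster_law)

lemma space_clusters: "g \<in> space (clusters \<eta> \<gamma>) \<Longrightarrow> x \<in> points \<gamma> \<Longrightarrow> g x \<in> generalised_configs"
  unfolding clusters_eq using sets_eq_imp_space_eq[OF sets_cluster_law, of x]
  by (auto simp: space_PiM PiE_iff)

lemma measurable_superpose_clusters:
  "\<gamma> \<in> generalised_configs \<Longrightarrow> superpose (points \<gamma>) \<in> clusters \<eta> \<gamma> \<rightarrow>\<^sub>M config_space"
  unfolding clusters_eq by (intro measurable_superpose countable_points) auto

lemma eta_kernel: "\<eta> \<in> borel \<rightarrow>\<^sub>M subprob_algebra seq_space"
  by (intro measurable_subprob_algebra prob_space_imp_subprob_space eta_prob eta_sets eta_meas)

lemma laplace_measurable: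
  assumes bs: "set bs \<subseteq> sets borel"
  shows "(\<lambda>x. \<integral>y. expneg (\<Sum>B\<leftarrow>bs. emeasure (seq_config y) B) \<partial>\<eta> x) \<in> borel_measurable borel"
proof -
  let ?f = "\<lambda>y. expneg (\<Sum>B\<leftarrow>bs. emeasure (seq_config y) B)"
  have "(\<lambda>\<xi>. \<Sum>B\<leftarrow>bs. emeasure \<xi> B) \<in> borel_measurable config_space"
    using bs by (rule measurable_config_sum_list)
  then have f: "?f \<in> borel_measurable seq_space"
    by (intro measurable_compose[OF measurable_seq_config] measurable_compose[OF _ expneg_measurable])
  then have "(\<lambda>y. ennreal (?f y)) \<in> borel_measurable seq_space" by simp
  then have "(\<lambda>x. \<integral>\<^sup>+y. ennreal (?f y) \<partial>\<eta> x) \<in> borel_measurable borel"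
    by (intro measurable_compose[OF eta_kernel nn_integral_measurable_subprob_algebra])
  then have "(\<lambda>x. enn2real (\<integral>\<^sup>+y. ennreal (?f y) \<partial>\<eta> x)) \<in> borel_measurable borel" by simp
  moreover have "(\<integral>y. ?f y \<partial>\<eta> x) = enn2real (\<integral>\<^sup>+y. ennreal (?f y) \<partial>\<eta> x)" for x
    using f by (intro integral_eq_nn_integral) (auto simp: expneg_bounds measurable_cong_sets[OF eta_sets refl])
  ultimately show ?thesis by simp
qed

text \<open>The product formula yields a sum over the set of centres; simplicity turns it into an
  integral against \<gamma>, in which the varying index set no longer appears.\<close>

lemma laplace_clusters:
  assumes \<gamma>: "\<gamma> \<in> generalised_configs" "simple_config \<gamma>" and bs: "set bs \<subseteq> sets borel"
  shows "(\<integral>\<xi>. expneg (\<Sum>B\<leftarrow>bs. emeasure \<xi> B) \<partial>distr (clusters \<eta> \<gamma>) config_space (superpose (points \<gamma>)))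
    = expneg (\<integral>\<^sup>+x. neglog (\<integral>y. expneg (\<Sum>B\<leftarrow>bs. emeasure (seq_config y) B) \<partial>\<eta> x) \<partial>\<gamma>)"
proof -
  let ?T = "\<lambda>\<xi>. \<Sum>B\<leftarrow>bs. emeasure \<xi> B" and ?I = "points \<gamma>"
  have T: "?T \<in> borel_measurable config_space"
    using bs by (rule measurable_config_sum_list)
  then have eT: "(\<lambda>\<xi>. expneg (?T \<xi>)) \<in> borel_measurable config_space"
    by (rule measurable_compose) (rule expneg_measurable)
  have "(\<integral>\<xi>. expneg (?T \<xi>) \<partial>distr (clusters \<eta> \<gamma>) config_space (superpose ?I))
      = (\<integral>g. expneg (?T (superpose ?I g)) \<partial>clusters \<eta> \<gamma>)"
    by (intro integral_distr measurable_superpose_clusters \<gamma> eT)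
  also have "\<dots> = (\<integral>g. expneg (\<integral>\<^sup>+x. ?T (g x) \<partial>count_space ?I) \<partial>clusters \<eta> \<gamma>)"
  proof (intro Bochner_Integration.integral_cong refl arg_cong[where f=expneg])
    fix g assume g: "g \<in> space (clusters \<eta> \<gamma>)"
    show "?T (superpose ?I g) = (\<integral>\<^sup>+x. ?T (g x) \<partial>count_space ?I)"
      using bs
    proof (induction bs)
      case (Cons B bs)
      then show ?case
        using space_clusters[OF g]
        by (simp add: nn_integral_add emeasure_superpose[OF countable_points[OF \<gamma>(1)]])
    qed simp
  qed
  also have "\<dots> = expneg (\<integral>\<^sup>+x. neglog (\<integral>\<xi>. expneg (?T \<xi>) \<partial>cluster_law x) \<partial>count_space ?I)"
    unfolding clusters_eq
    by (rule integral_expneg_PiM) (simp_all add: countable_points \<gamma> prob_cluster_law T measurable_cong_sets[OF sets_cluster_law refl])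
  also have "(\<lambda>x. \<integral>\<xi>. expneg (?T \<xi>) \<partial>cluster_law x) = (\<lambda>x. \<integral>y. expneg (?T (seq_config y)) \<partial>\<eta> x)"
    unfolding cluster_law_def by (intro ext integral_distr seq_config_eta eT)
  also have "(\<integral>\<^sup>+x. neglog (\<integral>y. expneg (?T (seq_config y)) \<partial>\<eta> x) \<partial>count_space ?I)
      = (\<integral>\<^sup>+x. neglog (\<integral>y. expneg (?T (seq_config y)) \<partial>\<eta> x) \<partial>\<gamma>)"
    by (intro nn_integral_simple[symmetric] \<gamma> measurable_compose[OF laplace_measurable[OF bs] neglog_measurable])
  finally show ?thesis .
qed

lemma cluster_kernel:
  obtains K where "K \<in> \<mu> \<rightarrow>\<^sub>M prob_algebra config_space"
    "AE \<gamma> in \<mu>. \<gamma> \<in> proper_configs \<and>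
      K \<gamma> = distr (clusters \<eta> \<gamma>) config_space (superpose (points \<gamma>))"
proof -
  obtain P where P: "P \<in> sets \<mu>" "P \<subseteq> proper_configs" "AE \<gamma> in \<mu>. \<gamma> \<in> P"
    by (rule proper_core)
  have Pg: "\<gamma> \<in> generalised_configs" "simple_config \<gamma>" if "\<gamma> \<in> P" for \<gamma>
    using P(2) that by (auto simp: proper_configs_def)
  \<comment> \<open>The empty configuration; off the measurable core the kernel is the Dirac measure
    there, so that it is a probability measure everywhere.\<close>
  let ?\<xi> = "superpose ({} :: nat set) (\<lambda>_. return borel undefined) :: 'a measure"
  have \<xi>: "?\<xi> \<in> space config_space"
    using superpose_return_generalised[of "{} :: nat set" "\<lambda>_. undefined"] by simp
  define K where "K \<gamma> = (if \<gamma> \<in> P then distr (clusters \<eta> \<gamma>) config_space (superpose (points \<gamma>))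
      else return config_space ?\<xi>)" for \<gamma>
  have "K \<in> \<mu> \<rightarrow>\<^sub>M prob_algebra config_space"
  proof (rule measurable_kernel_laplace)
    show "prob_space (K \<gamma>)" for \<gamma>
      unfolding K_def using \<xi>
      by (auto intro!: prob_space.prob_space_distr prob_clusters measurable_superpose_clusters
          prob_space_return dest: Pg)
    show "sets (K \<gamma>) = sets config_space" for \<gamma>
      by (simp add: K_def)
    fix bs :: "'a set list" assume bs: "set bs \<subseteq> sets borel"
    let ?T = "\<lambda>\<xi>. expneg (\<Sum>B\<leftarrow>bs. emeasure \<xi> B)"
    let ?\<phi> = "\<lambda>x. neglog (\<integral>y. ?T (seq_config y) \<partial>\<eta> x)"
    have "?\<phi> \<in> borel_measurable borel"
      by (rule measurable_compose[OF laplace_measurable[OF bs] neglog_measurable])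
    then have "(\<lambda>\<gamma>. \<integral>\<^sup>+x. ?\<phi> x \<partial>\<gamma>) \<in> borel_measurable config_space"
      by (rule measurable_config_nn_integral)
    then have "(\<lambda>\<gamma>. expneg (\<integral>\<^sup>+x. ?\<phi> x \<partial>\<gamma>)) \<in> borel_measurable \<mu>"
      unfolding measurable_cong_sets[OF mu_sets refl]
      by (rule measurable_compose) (rule expneg_measurable)
    then have "(\<lambda>\<gamma>. if \<gamma> \<in> P then expneg (\<integral>\<^sup>+x. ?\<phi> x \<partial>\<gamma>) else (\<integral>\<xi>. ?T \<xi> \<partial>return config_space ?\<xi>))
        \<in> borel_measurable \<mu>"
      using P(1) by (intro measurable_If_set) auto
    also have "(\<lambda>\<gamma>. if \<gamma> \<in> P then expneg (\<integral>\<^sup>+x. ?\<phi> x \<partial>\<gamma>) else (\<integral>\<xi>. ?T \<xi> \<partial>return config_space ?\<xi>))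
        = (\<lambda>\<gamma>. \<integral>\<xi>. ?T \<xi> \<partial>K \<gamma>)"
      using laplace_clusters[OF Pg bs] by (auto simp: K_def fun_eq_iff)
    finally show "(\<lambda>\<gamma>. \<integral>\<xi>. ?T \<xi> \<partial>K \<gamma>) \<in> borel_measurable \<mu>" .
  qed
  moreover have "AE \<gamma> in \<mu>. \<gamma> \<in> proper_configs \<and>
      K \<gamma> = distr (clusters \<eta> \<gamma>) config_space (superpose (points \<gamma>))"
    using P(3) by eventually_elim (use P(2) in \<open>auto simp: K_def\<close>)
  ultimately show thesis by (rule that)
qed

text \<open>The integrand defining \<open>cluster_measure\<close> agrees almost everywhere with a
  measurable kernel. Its set function is therefore that of a genuine measure, and
  \<open>measure_of\<close> does not degenerate.\<close>

lemma cluster_measure_bind: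
  obtains K where "K \<in> \<mu> \<rightarrow>\<^sub>M prob_algebra config_space" "cluster_measure \<mu> \<eta> = \<mu> \<bind> K"
    "AE \<gamma> in \<mu>. \<gamma> \<in> proper_configs \<and>
      K \<gamma> = distr (clusters \<eta> \<gamma>) config_space (superpose (points \<gamma>))"
proof -
  obtain K where K: "K \<in> \<mu> \<rightarrow>\<^sub>M prob_algebra config_space"
    "AE \<gamma> in \<mu>. \<gamma> \<in> proper_configs \<and>
      K \<gamma> = distr (clusters \<eta> \<gamma>) config_space (superpose (points \<gamma>))"
    by (rule cluster_kernel)
  interpret mu: prob_space \<mu> by (rule mu_prob)
  have Ks: "K \<in> \<mu> \<rightarrow>\<^sub>M subprob_algebra config_space" using K(1) by (rule measurable_prob_algebraD)
  have sets: "sets (\<mu> \<bind> K) = sets config_space"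
    using sets_kernel[OF Ks] mu.not_empty by (rule sets_bind)
  have "cluster_measure \<mu> \<eta> = measure_of generalised_configs (sets config_space) (emeasure (\<mu> \<bind> K))"
    unfolding cluster_measure_def
  proof (rule measure_of_eq)
    show "sets (config_space :: 'a measure measure) \<subseteq> Pow generalised_configs"
      using sets.space_closed[of "config_space :: 'a measure measure"] by simp
    fix A :: "'a measure set"
    assume "A \<in> sigma_sets generalised_configs (sets config_space)"
    then have A: "A \<in> sets config_space" using sets.sigma_sets_eq[of "config_space :: 'a measure measure"] by simp
    have "(\<integral>\<^sup>+\<gamma>. emeasure (distr (clusters \<eta> \<gamma>) config_space (superpose (points \<gamma>))) A \<partial>\<mu>)
        = (\<integral>\<^sup>+\<gamma>. emeasure (K \<gamma>) A \<partial>\<mu>)"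
      by (intro nn_integral_cong_AE eventually_mono[OF K(2)]) simp
    then show "(\<integral>\<^sup>+\<gamma>. emeasure (distr (clusters \<eta> \<gamma>) config_space (superpose (points \<gamma>))) A \<partial>\<mu>)
        = emeasure (\<mu> \<bind> K) A"
      using emeasure_bind[OF mu.not_empty Ks A] by simp
  qed
  also have "\<dots> = \<mu> \<bind> K"
    using measure_of_of_measure[of "\<mu> \<bind> K"] sets sets_eq_imp_space_eq[OF sets] by simp
  finally show thesis using K by (intro that)
qed

lemma sets_cluster_measure: "sets (cluster_measure \<mu> \<eta>) = sets config_space"
proof -
  have "sets (config_space :: 'a measure measure) \<subseteq> Pow generalised_configs"
    using sets.space_closed[of "config_space :: 'a measure measure"] by simp
  then show ?thesis
    unfolding cluster_measure_def using sets.sigma_sets_eq[of "config_space :: 'a measure measure"] by simp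
qed

lemma space_cluster_measure: "space (cluster_measure \<mu> \<eta>) = generalised_configs"
  using sets_eq_imp_space_eq[OF sets_cluster_measure] by simp

lemma prob_cluster_measure: "prob_space (cluster_measure \<mu> \<eta>)"
proof -
  obtain K where K: "K \<in> \<mu> \<rightarrow>\<^sub>M prob_algebra config_space" "cluster_measure \<mu> \<eta> = \<mu> \<bind> K"
    by (rule cluster_measure_bind)
  show ?thesis
    unfolding K(2) using measurable_space[OF K(1)]
    by (intro prob_space.prob_space_bind[OF mu_prob, where S=config_space] measurable_prob_algebraD K(1))
      (auto simp: space_prob_algebra)
qed

text \<open>Measurability of \<open>Q\<close> is essential for passing from the clusters to the
  image measure; for simplicity itself only the right-hand form is available, which is
  \<open>cluster_process_AE\<close>.\<close>

lemma AE_cluster_measure: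
  assumes Q: "{\<xi>\<in>generalised_configs. Q \<xi>} \<in> sets config_space"
  shows "(AE \<xi> in cluster_measure \<mu> \<eta>. Q \<xi>) \<longleftrightarrow>
    (AE \<gamma> in \<mu>. AE g in clusters \<eta> \<gamma>. Q (superpose (points \<gamma>) g))"
proof -
  obtain K where K: "K \<in> \<mu> \<rightarrow>\<^sub>M prob_algebra config_space" "cluster_measure \<mu> \<eta> = \<mu> \<bind> K"
    "AE \<gamma> in \<mu>. \<gamma> \<in> proper_configs \<and>
      K \<gamma> = distr (clusters \<eta> \<gamma>) config_space (superpose (points \<gamma>))"
    by (rule cluster_measure_bind)
  have Q': "Measurable.pred config_space Q" using Q by (simp add: pred_def)
  have "(AE \<xi> in cluster_measure \<mu> \<eta>. Q \<xi>) \<longleftrightarrow> (AE \<gamma> in \<mu>. AE \<xi> in K \<gamma>. Q \<xi>)"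
    unfolding K(2) by (rule AE_bind[OF measurable_prob_algebraD[OF K(1)] Q'])
  also have "\<dots> \<longleftrightarrow> (AE \<gamma> in \<mu>. AE g in clusters \<eta> \<gamma>. Q (superpose (points \<gamma>) g))"
  proof (rule eventually_subst)
    show "AE \<gamma> in \<mu>. (AE \<xi> in K \<gamma>. Q \<xi>) \<longleftrightarrow> (AE g in clusters \<eta> \<gamma>. Q (superpose (points \<gamma>) g))"
      using K(3)
    proof eventually_elim
      case (elim \<gamma>)
      then have g: "\<gamma> \<in> generalised_configs" by (simp add: proper_configs_def)
      from elim have K_eq: "K \<gamma> = distr (clusters \<eta> \<gamma>) config_space (superpose (points \<gamma>))" by blast
      show ?case
        unfolding K_eq using Q by (intro AE_distr_iff measurable_superpose_clusters g) simp
    qed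
  qed
  finally show ?thesis .
qed

lemma AE_cluster_law_iff:
  "{\<xi>\<in>generalised_configs. Q \<xi>} \<in> sets config_space \<Longrightarrow>
    (AE \<xi> in cluster_law x. Q \<xi>) \<longleftrightarrow> (AE y in \<eta> x. Q (seq_config y))"
  unfolding cluster_law_def by (intro AE_distr_iff seq_config_eta) simp

text \<open>A null set of one factor pulls back to a null set of the product, so this direction also
  covers properties such as local finiteness that may not be measurable.\<close>

lemma AE_clusters_component:
  "x \<in> points \<gamma> \<Longrightarrow> AE \<xi> in cluster_law x. Q \<xi> \<Longrightarrow> AE g in clusters \<eta> \<gamma>. Q (g x)"
  unfolding clusters_eq by (intro AE_PiM_component prob_cluster_law)

section \<open>Local finiteness\<close>

text \<open>Averaging the dominating kernel over the clusters of \<open>x\<close> gives a finite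
  substitute for their intensity measure: if the average vanishes on \<open>A\<close>, almost every
  cluster has no point there.\<close>

lemma cluster_intensity:
  obtains N where "N \<in> borel \<rightarrow>\<^sub>M subprob_algebra borel"
    "\<And>x A. A \<in> sets borel \<Longrightarrow> emeasure (N x) A = 0 \<Longrightarrow> AE \<xi> in cluster_law x. emeasure \<xi> A = 0"
proof -
  obtain T :: "'a measure \<Rightarrow> 'a measure" where T: "T \<in> config_space \<rightarrow>\<^sub>M subprob_algebra borel"
    "\<And>\<xi> A. \<xi> \<in> generalised_configs \<Longrightarrow> locally_finite_config \<xi> \<Longrightarrow> A \<in> sets borel \<Longrightarrow>
      emeasure (T \<xi>) A = 0 \<Longrightarrow> emeasure \<xi> A = 0"
    using dominating_kernel by blast
  have TS: "(\<lambda>y. T (seq_config y)) \<in> seq_space \<rightarrow>\<^sub>M subprob_algebra borel"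
    by (rule measurable_compose[OF measurable_seq_config T(1)])
  show thesis
  proof (rule that)
    show "(\<lambda>x. \<eta> x \<bind> (\<lambda>y. T (seq_config y))) \<in> borel \<rightarrow>\<^sub>M subprob_algebra borel"
      by (rule measurable_bind2[OF eta_kernel TS])
    fix x and A :: "'a set" assume A: "A \<in> sets borel"
      and 0: "emeasure (\<eta> x \<bind> (\<lambda>y. T (seq_config y))) A = 0"
    have TS': "(\<lambda>y. T (seq_config y)) \<in> \<eta> x \<rightarrow>\<^sub>M subprob_algebra borel"
      using TS by (simp cong: measurable_cong_sets add: eta_sets)
    have "(\<integral>\<^sup>+y. emeasure (T (seq_config y)) A \<partial>\<eta> x) = 0"
      using 0 emeasure_bind[OF prob_space.not_empty[OF eta_prob] TS' A] by simp
    then have "AE y in \<eta> x. emeasure (T (seq_config y)) A = 0"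
      using measurable_emeasure_kernel[OF TS' A] by (simp add: nn_integral_0_iff_AE)
    then have "AE y in \<eta> x. emeasure (seq_config y) A = 0"
      using eta_proper[of x] by eventually_elim (use T(2) A in auto)
    then show "AE \<xi> in cluster_law x. emeasure \<xi> A = 0"
      using pred_count[OF A, of "{0}"] by (subst AE_cluster_law_iff) auto
  qed
qed

lemma AE_cluster_law_finite:
  assumes "compact K" shows "AE \<xi> in cluster_law x. emeasure \<xi> K < \<infinity>"
proof -
  have K: "K \<in> sets borel" using assms by (rule borel_compact)
  have "AE y in \<eta> x. emeasure (seq_config y) K < \<infinity>"
    using eta_proper[of x] by eventually_elim (use assms in \<open>simp add: locally_finite_config_def\<close>)
  then show ?thesis
    using pred_count[OF K, of "{..<\<infinity>}"] by (subst AE_cluster_law_iff) auto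
qed

text \<open>\<open>eta_proper\<close> does not transfer directly, because null sets of
  \<open>\<eta> x\<close> need not come from null sets of its image. Finiteness on one compact set
  does transfer, and the capacity argument is then run for a single cluster with \<open>N x\<close>
  as dominating measure.\<close>

lemma AE_cluster_law_locally_finite: "AE \<xi> in cluster_law x. locally_finite_config \<xi>"
proof -
  obtain N where N: "N \<in> borel \<rightarrow>\<^sub>M subprob_algebra borel"
    "\<And>x A. A \<in> sets borel \<Longrightarrow> emeasure (N x) A = 0 \<Longrightarrow> AE \<xi> in cluster_law x. emeasure \<xi> A = 0"
    using cluster_intensity by blast
  show ?thesis
  proof (rule AE_locally_finite)
    show "finite_measure (cluster_law x)"
      by (rule prob_space.finite_measure[OF prob_cluster_law])
    show "finite_measure (N x)" "sets (N x) = sets borel"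
      using subprob_space_kernel[OF N(1), of x] sets_kernel[OF N(1), of x]
      by (auto simp: subprob_space_def)
  qed (use N(2) AE_cluster_law_finite in auto)
qed

text \<open>The dominating measure is a two-stage mixture: first a dominating measure for the
  centres, then \<open>N\<close> for the cluster of each centre.\<close>

lemma AE_cluster_measure_null:
  obtains \<nu> :: "'a measure" where "finite_measure \<nu>" "sets \<nu> = sets borel"
    "\<And>A. A \<in> sets borel \<Longrightarrow> emeasure \<nu> A = 0 \<Longrightarrow> AE \<xi> in cluster_measure \<mu> \<eta>. emeasure \<xi> A = 0"
proof -
  interpret mu: prob_space \<mu> by (rule mu_prob)
  obtain N where N: "N \<in> borel \<rightarrow>\<^sub>M subprob_algebra borel"
    "\<And>x A. A \<in> sets borel \<Longrightarrow> emeasure (N x) A = 0 \<Longrightarrow> AE \<xi> in cluster_law x. emeasure \<xi> A = 0"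
    using cluster_intensity by blast
  obtain T :: "'a measure \<Rightarrow> 'a measure" where T: "T \<in> config_space \<rightarrow>\<^sub>M subprob_algebra borel"
    "\<And>\<xi> A. \<xi> \<in> generalised_configs \<Longrightarrow> locally_finite_config \<xi> \<Longrightarrow> A \<in> sets borel \<Longrightarrow>
      emeasure (T \<xi>) A = 0 \<Longrightarrow> emeasure \<xi> A = 0"
    using dominating_kernel by blast
  have T': "T \<in> \<mu> \<rightarrow>\<^sub>M subprob_algebra borel" using T(1) by (simp cong: measurable_cong_sets add: mu_sets)
  define \<theta> where "\<theta> = \<mu> \<bind> T"
  have \<theta>: "subprob_space \<theta>" "sets \<theta> = sets borel"
    unfolding \<theta>_def using sets_kernel[OF T'] mu.not_empty
    by (auto intro!: subprob_space_bind[OF mu.subprob_space_axioms T'] sets_bind)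
  have N': "N \<in> \<theta> \<rightarrow>\<^sub>M subprob_algebra borel" using N(1) by (simp cong: measurable_cong_sets add: \<theta>(2))
  show thesis
  proof (rule that)
    have "subprob_space (\<theta> \<bind> N)" by (rule subprob_space_bind[OF \<theta>(1) N'])
    then show "finite_measure (\<theta> \<bind> N)" by (simp add: subprob_space_def)
    show "sets (\<theta> \<bind> N) = sets borel"
      using sets_kernel[OF N'] subprob_space.subprob_not_empty[OF \<theta>(1)] by (rule sets_bind)
    fix A :: "'a set" assume A: "A \<in> sets borel" and 0: "emeasure (\<theta> \<bind> N) A = 0"
    have Nm: "(\<lambda>x. emeasure (N x) A) \<in> borel_measurable borel"
      by (rule measurable_emeasure_kernel[OF N(1) A])
    \<comment> \<open>The centres whose clusters may meet \<open>A\<close>. This set is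
      \<theta>-null, so almost surely it contains no centre, and the countably many clusters all
      miss \<open>A\<close>.\<close>
    let ?Z = "{x. emeasure (N x) A \<noteq> 0}"
    have Z: "?Z \<in> sets borel"
      using measurable_sets[OF Nm, of "- {0}"] by (simp add: vimage_def Compl_eq)
    have "(\<integral>\<^sup>+x. emeasure (N x) A \<partial>\<theta>) = 0"
      using 0 emeasure_bind[OF subprob_space.subprob_not_empty[OF \<theta>(1)] N' A] by simp
    then have "AE x in \<theta>. emeasure (N x) A = 0"
      using measurable_emeasure_kernel[OF N' A] by (simp add: nn_integral_0_iff_AE)
    then have "emeasure \<theta> ?Z = 0"
      using Z sets_eq_imp_space_eq[OF \<theta>(2)] \<theta>(2)
      by (subst (asm) AE_iff_measurable[of ?Z]) auto
    then have "(\<integral>\<^sup>+\<gamma>. emeasure (T \<gamma>) ?Z \<partial>\<mu>) = 0"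
      using emeasure_bind[OF mu.not_empty T' Z] by (simp add: \<theta>_def)
    then have "AE \<gamma> in \<mu>. emeasure (T \<gamma>) ?Z = 0"
      using measurable_emeasure_kernel[OF T' Z] by (simp add: nn_integral_0_iff_AE)
    then have "AE \<gamma> in \<mu>. AE g in clusters \<eta> \<gamma>. emeasure (superpose (points \<gamma>) g) A = 0"
      using AE_proper
    proof eventually_elim
      case (elim \<gamma>)
      then have g: "\<gamma> \<in> generalised_configs" "locally_finite_config \<gamma>"
        by (auto simp: proper_configs_def)
      have "emeasure (N x) A = 0" if "x \<in> points \<gamma>" for x
      proof (rule ccontr)
        assume "emeasure (N x) A \<noteq> 0"
        then have "emeasure \<gamma> {x} \<le> emeasure \<gamma> ?Z" using Z g by (intro emeasure_mono) auto
        also have "\<dots> = 0" using T(2)[OF g Z] elim by simp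
        finally show False using that by (simp add: points_def)
      qed
      then have "AE g in clusters \<eta> \<gamma>. \<forall>x\<in>points \<gamma>. emeasure (g x) A = 0"
        using countable_points[OF g(1)] N(2)[OF A]
        by (subst AE_ball_countable) (auto intro: AE_clusters_component)
      then show ?case
        using AE_space
      proof eventually_elim
        case (elim h)
        have "emeasure (superpose (points \<gamma>) h) A = (\<integral>\<^sup>+x. emeasure (h x) A \<partial>count_space (points \<gamma>))"
          using space_clusters[OF elim(2)] A by (intro emeasure_superpose countable_points g) auto
        also have "\<dots> = (\<integral>\<^sup>+x. 0 \<partial>count_space (points \<gamma>))"
          using elim(1) by (intro nn_integral_cong) auto
        finally show ?case by simp
      qed
    qed
    then show "AE \<xi> in cluster_measure \<mu> \<eta>. emeasure \<xi> A = 0"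
      using pred_count[OF A, of "{0}"] by (subst AE_cluster_measure) auto
  qed
qed

lemma emeasure_cluster_law_hitting:
  assumes B: "B \<in> sets borel"
  shows "emeasure (cluster_law x) {\<xi>\<in>generalised_configs. emeasure \<xi> B \<noteq> 0} = emeasure (\<eta> x) (hitting B)"
proof -
  have "{\<xi>\<in>generalised_configs. emeasure \<xi> B \<in> - {0}} \<in> sets config_space"
    by (rule pred_count[OF B]) simp
  then have "emeasure (cluster_law x) {\<xi>\<in>generalised_configs. emeasure \<xi> B \<noteq> 0}
      = emeasure (\<eta> x) (seq_config -` {\<xi>\<in>generalised_configs. emeasure \<xi> B \<noteq> 0} \<inter> space (\<eta> x))"
    unfolding cluster_law_def by (intro emeasure_distr seq_config_eta) simp
  also have "seq_config -` {\<xi>\<in>generalised_configs. emeasure \<xi> B \<noteq> 0} \<inter> space (\<eta> x) = hitting B"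
    using sets_eq_imp_space_eq[OF eta_sets, of x] B
    by (auto simp: hitting_def emeasure_seq_config_eq_0_iff)
  finally show ?thesis .
qed

text \<open>Given the centres, the sum in the hypothesis is the mean number of clusters that hit
  \<open>K\<close>. It is finite for almost all centre configurations, so finitely many clusters hit
  \<open>K\<close>, each with finitely many points in it.\<close>

lemma AE_cluster_measure_finite:
  assumes K: "compact K"
    and fin: "(\<integral>\<^sup>+\<gamma>\<in>proper_configs. (\<Sum>\<^sub>\<infinity>x\<in>points \<gamma>. emeasure (\<eta> x) (hitting K)) \<partial>\<mu>) < \<infinity>"
  shows "AE \<xi> in cluster_measure \<mu> \<eta>. emeasure \<xi> K < \<infinity>"
proof -
  have Kb: "K \<in> sets borel" using K by (rule borel_compact)
  let ?f = "\<lambda>x. emeasure (\<eta> x) (hitting K)"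
  have f: "?f \<in> borel_measurable borel" by (rule eta_meas[OF hitting_sets[OF Kb]])
  have eq: "(\<Sum>\<^sub>\<infinity>x\<in>points \<gamma>. ?f x) = (\<integral>\<^sup>+x. ?f x \<partial>\<gamma>)" if "\<gamma> \<in> proper_configs" for \<gamma>
    using that nn_integral_simple[of \<gamma>, OF _ _ f]
    by (simp add: proper_configs_def infsum_ennreal_count_space countable_points)
  \<comment> \<open>The integrand of the hypothesis is not evidently measurable; almost everywhere
    it equals an integral against \<gamma>, which is, so finiteness of the integral yields
    finiteness almost everywhere.\<close>
  have "(\<integral>\<^sup>+\<gamma>. (\<integral>\<^sup>+x. ?f x \<partial>\<gamma>) \<partial>\<mu>) = (\<integral>\<^sup>+\<gamma>\<in>proper_configs. (\<Sum>\<^sub>\<infinity>x\<in>points \<gamma>. ?f x) \<partial>\<mu>)"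
    using AE_proper by (intro nn_integral_cong_AE) (auto elim!: eventually_mono simp: eq)
  then have "AE \<gamma> in \<mu>. (\<integral>\<^sup>+x. ?f x \<partial>\<gamma>) \<noteq> \<infinity>"
    using fin measurable_config_nn_integral[OF f]
    by (intro nn_integral_PInf_AE) (auto simp: measurable_cong_sets[OF mu_sets refl])
  then have "AE \<gamma> in \<mu>. AE g in clusters \<eta> \<gamma>. emeasure (superpose (points \<gamma>) g) K < \<infinity>"
    using AE_proper
  proof eventually_elim
    case (elim \<gamma>)
    then have g: "\<gamma> \<in> generalised_configs" "simple_config \<gamma>"
      by (auto simp: proper_configs_def)
    let ?I = "points \<gamma>" and ?E = "{\<xi>\<in>generalised_configs. emeasure \<xi> K \<noteq> 0}"
    have cI: "countable ?I" by (rule countable_points[OF g(1)])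
    have E: "?E \<in> sets config_space" using pred_count[OF Kb, of "- {0}"] by simp
    have comp: "(\<lambda>h. h x) \<in> clusters \<eta> \<gamma> \<rightarrow>\<^sub>M cluster_law x" if "x \<in> ?I" for x
      unfolding clusters_eq by (rule measurable_component_singleton[OF that])
    have m: "(\<lambda>h. indicator ?E (h x) :: ennreal) \<in> borel_measurable (clusters \<eta> \<gamma>)" if "x \<in> ?I" for x
      by (rule measurable_compose[OF comp[OF that] borel_measurable_indicator]) (simp add: E)
    have "(\<integral>\<^sup>+h. (\<integral>\<^sup>+x. indicator ?E (h x) \<partial>count_space ?I) \<partial>clusters \<eta> \<gamma>)
        = (\<integral>\<^sup>+x. (\<integral>\<^sup>+h. indicator ?E (h x) \<partial>clusters \<eta> \<gamma>) \<partial>count_space ?I)"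
      by (rule nn_integral_count_space_nn_integral[OF cI m])
    also have "\<dots> = (\<integral>\<^sup>+x. ?f x \<partial>count_space ?I)"
    proof (rule nn_integral_cong)
      fix x assume "x \<in> space (count_space ?I)"
      then have x: "x \<in> ?I" by simp
      have "(\<integral>\<^sup>+h. indicator ?E (h x) \<partial>clusters \<eta> \<gamma>)
          = (\<integral>\<^sup>+\<xi>. indicator ?E \<xi> \<partial>distr (clusters \<eta> \<gamma>) (cluster_law x) (\<lambda>h. h x))"
        by (intro nn_integral_distr[symmetric] comp[OF x] borel_measurable_indicator) (simp add: E)
      also have "distr (clusters \<eta> \<gamma>) (cluster_law x) (\<lambda>h. h x) = cluster_law x"
        unfolding clusters_eq by (rule distr_PiM_component[OF prob_cluster_law x])
      also have "(\<integral>\<^sup>+\<xi>. indicator ?E \<xi> \<partial>cluster_law x) = ?f x"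
        using E emeasure_cluster_law_hitting[OF Kb, of x] by simp
      finally show "(\<integral>\<^sup>+h. indicator ?E (h x) \<partial>clusters \<eta> \<gamma>) = ?f x" .
    qed
    also have "\<dots> \<noteq> \<infinity>" using elim nn_integral_simple[OF g f] by simp
    finally have "AE h in clusters \<eta> \<gamma>. (\<integral>\<^sup>+x. indicator ?E (h x) \<partial>count_space ?I) \<noteq> \<infinity>"
      by (intro nn_integral_PInf_AE borel_measurable_nn_integral_count_space[OF cI m])
    moreover have "AE h in clusters \<eta> \<gamma>. \<forall>x\<in>?I. emeasure (h x) K < \<infinity>"
      using cI AE_cluster_law_finite[OF K]
      by (subst AE_ball_countable) (auto intro: AE_clusters_component)
    ultimately show ?case
      using AE_space
    proof eventually_elim
      case (elim h)
      note h = space_clusters[OF elim(3)]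
      let ?F = "{x\<in>?I. emeasure (h x) K \<noteq> 0}"
      have "(\<integral>\<^sup>+x. indicator ?E (h x) \<partial>count_space ?I) = (\<integral>\<^sup>+x. indicator ?F x \<partial>count_space ?I)"
        using h by (intro nn_integral_cong) (auto simp: indicator_def)
      also have "\<dots> = emeasure (count_space ?I) ?F" by (intro nn_integral_indicator) auto
      finally have F: "finite ?F" using elim(1) by (auto simp: emeasure_count_space split: if_splits)
      have "emeasure (superpose ?I h) K = (\<integral>\<^sup>+x. emeasure (h x) K \<partial>count_space ?I)"
        using h Kb by (intro emeasure_superpose cI) auto
      also have "\<dots> = (\<integral>\<^sup>+x. emeasure (h x) K \<partial>count_space ?F)"
        by (subst (1 2) nn_integral_count_space_indicator) (auto intro!: nn_integral_cong split: split_indicator)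
      also have "\<dots> = (\<Sum>x\<in>?F. emeasure (h x) K)" by (rule nn_integral_count_space_finite[OF F])
      also have "\<dots> < \<infinity>" using elim(2) F by (auto simp: less_top[symmetric])
      finally show ?case .
    qed
  qed
  then show ?thesis
    using pred_count[OF Kb, of "{..<\<infinity>}"] by (subst AE_cluster_measure) auto
qed

lemma AE_cluster_measure_locally_finite:
  assumes "\<And>K. compact K \<Longrightarrow>
    (\<integral>\<^sup>+\<gamma>\<in>proper_configs. (\<Sum>\<^sub>\<infinity>x\<in>points \<gamma>. emeasure (\<eta> x) (hitting K)) \<partial>\<mu>) < \<infinity>"
  shows "AE \<xi> in cluster_measure \<mu> \<eta>. locally_finite_config \<xi>"
proof -
  obtain \<nu> :: "'a measure" where \<nu>: "finite_measure \<nu>" "sets \<nu> = sets borel"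
    "\<And>A. A \<in> sets borel \<Longrightarrow> emeasure \<nu> A = 0 \<Longrightarrow> AE \<xi> in cluster_measure \<mu> \<eta>. emeasure \<xi> A = 0"
    using AE_cluster_measure_null by blast
  show ?thesis
    using prob_space.finite_measure[OF prob_cluster_measure] sets_cluster_measure \<nu>
      AE_cluster_measure_finite[OF _ assms]
    by (rule AE_locally_finite) auto
qed

section \<open>Simplicity\<close>

text \<open>Carries events from families of sequences, where the disjointness condition lives, to
  families of configurations.\<close>

lemma AE_clusters_seq:
  assumes \<gamma>: "\<gamma> \<in> generalised_configs"
    and Q: "{g \<in> space (clusters \<eta> \<gamma>). Q g} \<in> sets (clusters \<eta> \<gamma>)"
    and ae: "AE y in PiM (points \<gamma>) \<eta>. Q (\<lambda>x\<in>points \<gamma>. seq_config (y x))"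
  shows "AE g in clusters \<eta> \<gamma>. Q g"
proof -
  let ?N = "PiM (points \<gamma>) (\<lambda>_. config_space :: 'a measure measure)" and ?F = "\<lambda>y. \<lambda>x\<in>points \<gamma>. seq_config (y x)"
  have eq: "clusters \<eta> \<gamma> = distr (PiM (points \<gamma>) \<eta>) ?N ?F"
    unfolding clusters_def by (rule distr_PiM_map[symmetric, OF eta_prob seq_config_eta])
  have F: "?F \<in> PiM (points \<gamma>) \<eta> \<rightarrow>\<^sub>M ?N"
  proof (rule measurable_restrict)
    show "(\<lambda>y. seq_config (y x)) \<in> PiM (points \<gamma>) \<eta> \<rightarrow>\<^sub>M config_space" if "x \<in> points \<gamma>" for x
      by (rule measurable_compose[OF measurable_component_singleton[OF that] seq_config_eta])
  qed
  have "{g \<in> space ?N. Q g} \<in> sets ?N" using Q unfolding eq by simp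
  from AE_distr_iff[OF F this] ae show ?thesis unfolding eq by simp
qed

text \<open>Simplicity of a pair is not known to be measurable: the hull \<open>S\<close> carries it
  from sequences to clusters, and local finiteness of the pair turns membership in \<open>S\<close>
  back into simplicity. Countably many pairs are handled at once. \<open>S\<close> cannot be applied
  to the whole superposition, which may fail to be locally finite here.\<close>

lemma cluster_process_AE_simple:
  assumes "AE \<gamma> in \<mu>. emeasure (PiM (points \<gamma>) \<eta>) (disjoint_distinct_families \<gamma>) = 1"
  shows "cluster_process_AE \<mu> \<eta> simple_config"
proof -
  obtain S :: "'a measure set" where S: "S \<in> sets config_space"
    "\<And>\<gamma>. \<gamma> \<in> generalised_configs \<Longrightarrow> simple_config \<gamma> \<Longrightarrow> \<gamma> \<in> S"
    "\<And>\<gamma>. \<gamma> \<in> S \<Longrightarrow> locally_finite_config \<gamma> \<Longrightarrow> simple_config \<gamma>"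
    using simple_config_hull by blast
  show ?thesis
    unfolding cluster_process_AE_def
    using assms AE_proper
  proof eventually_elim
    case (elim \<gamma>)
    then have \<gamma>: "\<gamma> \<in> generalised_configs" by (simp add: proper_configs_def)
    let ?I = "points \<gamma>"
    have cI: "countable ?I" by (rule countable_points[OF \<gamma>])
    interpret E: prob_space "PiM ?I \<eta>" by (intro prob_space_PiM eta_prob)
    have disj: "AE y in PiM ?I \<eta>. y \<in> disjoint_distinct_families \<gamma>"
      using elim(1) by (intro E.AE_prob_1) (simp add: E.emeasure_eq_measure)
    have "AE h in clusters \<eta> \<gamma>. superpose {x1, x2} h \<in> S" if x: "x1 \<in> ?I" "x2 \<in> ?I" for x1 x2
    proof (rule AE_clusters_seq[OF \<gamma>])
      have "superpose {x1, x2} \<in> clusters \<eta> \<gamma> \<rightarrow>\<^sub>M config_space"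
        unfolding clusters_eq using x by (intro measurable_superpose) auto
      from measurable_sets[OF this S(1)]
      show "{h \<in> space (clusters \<eta> \<gamma>). superpose {x1, x2} h \<in> S} \<in> sets (clusters \<eta> \<gamma>)"
        by (simp add: vimage_def Int_def conj_commute)
      show "AE y in PiM ?I \<eta>. superpose {x1, x2} (\<lambda>x\<in>?I. seq_config (y x)) \<in> S"
        using disj
      proof eventually_elim
        case (elim y)
        have "superpose {x1, x2} (\<lambda>x\<in>?I. seq_config (y x)) = superpose {x1, x2} (\<lambda>x. seq_config (y x))"
          using x by (intro superpose_cong) auto
        with superpose_pair_simple[OF elim x] show ?case
          by (auto intro!: S(2) superpose_generalised)
      qed
    qed
    then have "AE h in clusters \<eta> \<gamma>. \<forall>x1\<in>?I. \<forall>x2\<in>?I. superpose {x1, x2} h \<in> S"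
      using cI by (simp add: AE_ball_countable)
    moreover have "AE h in clusters \<eta> \<gamma>. \<forall>x\<in>?I. locally_finite_config (h x)"
      using cI AE_cluster_law_locally_finite by (subst AE_ball_countable) (auto intro: AE_clusters_component)
    ultimately show ?case
      using AE_space
    proof eventually_elim
      case (elim h)
      note h = space_clusters[OF elim(3)]
      show ?case
      proof (rule superpose_simple[OF cI h])
        fix x1 x2 assume x: "x1 \<in> ?I" "x2 \<in> ?I"
        have "locally_finite_config (superpose {x1, x2} h)"
          unfolding locally_finite_config_def
        proof (intro allI impI)
          fix B :: "'a set" assume B: "compact B"
          have "emeasure (superpose {x1, x2} h) B = (\<Sum>x\<in>{x1, x2}. emeasure (h x) B)"
            using x h B by (subst emeasure_superpose) (auto simp: nn_integral_count_space_finite borel_compact)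
          also have "\<dots> < \<infinity>"
            using elim(2) x B by (auto simp: locally_finite_config_def less_top[symmetric])
          finally show "emeasure (superpose {x1, x2} h) B < \<infinity>" .
        qed
        with S(3) elim(1) x show "simple_config (superpose {x1, x2} h)" by blast
      qed
    qed
  qed
qed

text \<open>For a property that may not be measurable, the statement about the process still gives
  full measure to every measurable set containing it.\<close>

lemma cluster_process_AE_imp_AE:
  assumes ae: "cluster_process_AE \<mu> \<eta> Q" and S: "S \<in> sets config_space"
    and sub: "\<And>\<xi>. \<xi> \<in> generalised_configs \<Longrightarrow> Q \<xi> \<Longrightarrow> \<xi> \<in> S"
  shows "AE \<xi> in cluster_measure \<mu> \<eta>. \<xi> \<in> S"
proof -
  have "{\<xi>\<in>generalised_configs. \<xi> \<in> S} \<in> sets config_space"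
    using S sets.sets_into_space[OF S] by (simp add: Int_def[symmetric] Int_absorb1)
  moreover have "AE \<gamma> in \<mu>. AE g in clusters \<eta> \<gamma>. superpose (points \<gamma>) g \<in> S"
    using ae[unfolded cluster_process_AE_def] AE_proper
  proof eventually_elim
    case (elim \<gamma>)
    then have \<gamma>: "\<gamma> \<in> generalised_configs" by (simp add: proper_configs_def)
    from elim(1) AE_space show ?case
      by eventually_elim
        (use sub space_clusters superpose_generalised[OF countable_points[OF \<gamma>]] in blast)
  qed
  ultimately show ?thesis by (subst AE_cluster_measure)
qed

end

text \<open>Simplicity takes three forms because its event may lie outside the completed
  sigma-algebra: for the process itself, on locally finite configurations, and for the cluster
  measure once the event is measurable in the completion.\<close>

theorem theorem3p4:
  fixes \<mu> :: "'a::polish_space measure measure"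
    and \<eta> :: "'a \<Rightarrow> (enat \<times> (nat \<Rightarrow> 'a)) measure"
  assumes mu_prob: "prob_space \<mu>"
    and mu_sets: "sets \<mu> = sets config_space"
    and mu_proper: "emeasure (completion \<mu>) proper_configs = 1"
    and eta_prob: "\<And>x. prob_space (\<eta> x)"
    and eta_sets: "\<And>x. sets (\<eta> x) = sets seq_space"
    and eta_meas: "\<And>B. B \<in> sets seq_space \<Longrightarrow> (\<lambda>x. emeasure (\<eta> x) B) \<in> borel_measurable borel"
    and eta_proper: "\<And>x. AE y in \<eta> x.
          locally_finite_config (seq_config y) \<and> simple_config (seq_config y)"
  shows "((\<forall>B. compact B \<longrightarrow>
            (\<integral>\<^sup>+\<gamma>\<in>proper_configs. (\<Sum>\<^sub>\<infinity>x\<in>points \<gamma>. emeasure (\<eta> x) (hitting B)) \<partial>\<mu>) < \<infinity>)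
          \<longrightarrow> (AE \<gamma> in cluster_measure \<mu> \<eta>. locally_finite_config \<gamma>))
    \<and> ((AE \<gamma> in \<mu>. emeasure (PiM (points \<gamma>) \<eta>) (disjoint_distinct_families \<gamma>) = 1)
          \<longrightarrow> cluster_process_AE \<mu> \<eta> simple_config
            \<and> (AE \<gamma> in cluster_measure \<mu> \<eta>. locally_finite_config \<gamma> \<longrightarrow> simple_config \<gamma>)
            \<and> ({\<gamma>\<in>generalised_configs. simple_config \<gamma>} \<in> sets (completion (cluster_measure \<mu> \<eta>))
                \<longrightarrow> (AE \<gamma> in cluster_measure \<mu> \<eta>. simple_config \<gamma>)))
    \<and> ((\<forall>B. compact B \<longrightarrow>
            (\<integral>\<^sup>+\<gamma>\<in>proper_configs. (\<Sum>\<^sub>\<infinity>x\<in>points \<gamma>. emeasure (\<eta> x) (hitting B)) \<partial>\<mu>) < \<infinity>)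
        \<and> (AE \<gamma> in \<mu>. emeasure (PiM (points \<gamma>) \<eta>) (disjoint_distinct_families \<gamma>) = 1)
          \<longrightarrow> emeasure (completion (cluster_measure \<mu> \<eta>)) proper_configs = 1)"
proof -
  interpret cluster_process \<mu> \<eta>
    by (rule cluster_process.intro) (fact assms)+
  let ?Q = "cluster_measure \<mu> \<eta>"
  let ?fin = "\<forall>B. compact B \<longrightarrow>
    (\<integral>\<^sup>+\<gamma>\<in>proper_configs. (\<Sum>\<^sub>\<infinity>x\<in>points \<gamma>. emeasure (\<eta> x) (hitting B)) \<partial>\<mu>) < \<infinity>"
  let ?disj = "AE \<gamma> in \<mu>. emeasure (PiM (points \<gamma>) \<eta>) (disjoint_distinct_families \<gamma>) = 1"
  interpret Q: prob_space ?Q by (rule prob_cluster_measure)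
  have lf: "AE \<gamma> in ?Q. locally_finite_config \<gamma>" if ?fin
    using that by (intro AE_cluster_measure_locally_finite) blast
  have process: "cluster_process_AE \<mu> \<eta> simple_config" if ?disj
    using that by (rule cluster_process_AE_simple)
  have lf_simple: "AE \<gamma> in ?Q. locally_finite_config \<gamma> \<longrightarrow> simple_config \<gamma>" if ?disj
  proof -
    obtain S :: "'a measure set" where S: "S \<in> sets config_space"
      "\<And>\<gamma>. \<gamma> \<in> generalised_configs \<Longrightarrow> simple_config \<gamma> \<Longrightarrow> \<gamma> \<in> S"
      "\<And>\<gamma>. \<gamma> \<in> S \<Longrightarrow> locally_finite_config \<gamma> \<Longrightarrow> simple_config \<gamma>"
      using simple_config_hull by blast
    have "AE \<gamma> in ?Q. \<gamma> \<in> S"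
      using process[OF that] S(1,2) by (rule cluster_process_AE_imp_AE)
    then show ?thesis by (rule eventually_mono) (use S(3) in blast)
  qed
  have simple: "AE \<gamma> in ?Q. simple_config \<gamma>"
    if ?disj and "{\<gamma>\<in>generalised_configs. simple_config \<gamma>} \<in> sets (completion ?Q)"
  proof -
    let ?N = "generalised_configs - {\<gamma>\<in>generalised_configs. simple_config \<gamma>}"
    have "space (completion ?Q) - {\<gamma>\<in>generalised_configs. simple_config \<gamma>} \<in> sets (completion ?Q)"
      using that(2) by (rule sets.compl_sets)
    then have N: "?N \<in> sets (completion ?Q)" by (simp add: space_cluster_measure)
    \<comment> \<open>A measurable subset of the non-simple configurations. Its complement contains
      all simple ones and so has full measure; what remains of \<open>?N\<close> is its null
      part.\<close>
    let ?D = "main_part ?Q ?N"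
    have D: "?D \<in> sets config_space" "?D \<subseteq> ?N"
      using main_part_sets[OF N] main_part_null_part_Un[OF N] by (auto simp: sets_cluster_measure)
    have "AE \<gamma> in ?Q. \<gamma> \<in> space config_space - ?D"
      by (rule cluster_process_AE_imp_AE[OF process[OF that(1)] sets.compl_sets[OF D(1)]])
        (use D(2) in auto)
    moreover have "AE \<gamma> in ?Q. \<gamma> \<notin> null_part ?Q ?N"
      using AE_notin_null_part[OF N] by (simp add: AE_completion_iff)
    ultimately show ?thesis
      using AE_space
    proof eventually_elim
      case (elim \<gamma>)
      then have "\<gamma> \<notin> ?N" using main_part_null_part_Un[OF N] by blast
      with elim(3) show ?case by (simp add: space_cluster_measure)
    qed
  qed
  have proper: "emeasure (completion ?Q) proper_configs = 1" if ?fin ?disj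
  proof -
    have ae: "AE \<gamma> in ?Q. \<gamma> \<in> proper_configs"
      using lf[OF that(1)] lf_simple[OF that(2)] AE_space
      by eventually_elim (simp add: proper_configs_def space_cluster_measure)
    \<comment> \<open>A property that fails almost surely is measurable in the completion; the
      double negation brings the goal into that form.\<close>
    then have "Measurable.pred (completion ?Q) (\<lambda>\<gamma>. \<not> \<gamma> \<notin> proper_configs)"
      by (intro pred_intros_logic sets_completion_AE) simp
    then have "{\<gamma>\<in>generalised_configs. \<gamma> \<in> proper_configs} \<in> sets (completion ?Q)"
      by (simp add: pred_def space_cluster_measure)
    also have "{\<gamma>\<in>generalised_configs. \<gamma> \<in> proper_configs} = (proper_configs :: 'a measure set)"
      by (auto simp: proper_configs_def)
    finally show ?thesis
      using ae by (intro prob_space.emeasure_eq_1_AE[OF Q.prob_space_completion]) (simp_all add: AE_completion_iff)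
  qed
  show ?thesis
    using lf process lf_simple simple proper by blast
qed

end
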